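(* Let $X\subset\mathbb{R}^N$ be a Borel set, $\mu$ a Borel probability measure on $X$ and $T\colon X \to X$ a continuous map. Let $h \colon X \to \mathbb{R}$ be a continuous observable and $k \in \mathbb{N}$. Let $\phi$ be the $k$-delay coordinate map $\phi(x)=(h(x),\dots,h(T^{k-1}x))$ and let $S$ denote the prediction map (when it exists). Then the following hold. (i) If $\phi\circ T \in L^2(\mu)$ (e.g. if $h$ is bounded) and $h$ is almost surely deterministically $k$-predictable with respect to $\mu$, then $S \in L^2(\phi_*\mu)$ and $$\sigma_\varepsilon(y) = \bigg(\frac{1}{\phi_*\mu(B(y,\varepsilon))} \int_{B(y,\varepsilon)} \|S - \chi_\varepsilon(y)\|^2 \, d\phi_*\mu\bigg)^{\frac 1 2} \xrightarrow[\varepsilon\to 0]{} 0$$ for $\phi_*\mu$-almost every $y \in \phi(X)$, so $h$ is almost surely $k$-predictable with respect to $\mu$. (ii) If $X$ is compact, then $h$ is almost surely deterministically $k$-predictable with respect to $\mu$ if and only if it is almost surely $k$-predictable with respect to $\mu$. Moreover, if the measure $\mu$ is $T$-invariant, then the assumption $\phi\circ T \in L^2(\mu)$ in assertion (i) can be replaced by $h \in L^2(\mu)$.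
   Context: $\|\cdot\|$ is the Euclidean norm; $B(y,\varepsilon)$ is the open ball; $\phi_*\mu$ is the push-forward measure. For $y\in\mathbb{R}^k$ and $\varepsilon>0$ with $\mu(\phi^{-1}(B(y,\varepsilon)))>0$ let $$\chi_\varepsilon(y)=\frac{1}{\mu(\phi^{-1}(B(y,\varepsilon)))}\int_{\phi^{-1}(B(y,\varepsilon))}\phi\circ T\,d\mu,\qquad \sigma_\varepsilon(y)=\Big(\frac{1}{\mu(\phi^{-1}(B(y,\varepsilon)))}\int_{\phi^{-1}(B(y,\varepsilon))}\|\phi(T(x))-\chi_\varepsilon(y)\|^2d\mu(x)\Big)^{1/2}$$ (provided the integrals exist). A point $y$ in the support of $\phi_*\mu$ is $k$-predictable if $\lim_{\varepsilon\to0}\sigma_\varepsilon(y)$ exists and equals $0$; $h$ is almost surely $k$-predictable with respect to $\mu$ if $\phi_*\mu$-almost every $y\in\mathbb{R}^k$ is $k$-predictable. The observable $h$ is almost surely deterministically $k$-predictable with respect to $\mu$ if there is a Borel set $X_h\subset X$ of full $\mu$-measure such that for all $x_1,x_2\in X_h$, $\phi(x_1)=\phi(x_2)$ implies $\phi(Tx_1)=\phi(Tx_2)$. Equivalently, there is a map $S\colon\phi(X_h)\to\phi(X)$ with $\phi(Tx)=S(\phi(x))$ for all $x\in X_h$; $S$ is called the prediction map. It is defined $\phi_*\mu$-almost everywhere, and (for continuous $T,h$) $X_h$ is chosen so that $\phi(X_h)$ and $S$ are Borel. *)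

theory Defs
  imports "HOL-Probability.Probability"
begin

text \<open>
  The dimension \<open>k\<close> is the cardinality of the linearly ordered finite index type \<open>'k\<close>;
  \<open>card {..<i}\<close> is the rank of the index \<open>i\<close>, running through \<open>0, \<dots>, k - 1\<close>, so that the
  coordinates in increasing order are \<open>h x, h (T x), \<dots>, h ((T ^^ (k - 1)) x)\<close>.
\<close>
definition delay_map :: "('a \<Rightarrow> 'a) \<Rightarrow> ('a \<Rightarrow> real) \<Rightarrow> 'a \<Rightarrow> real ^ ('k :: {finite, linorder})"
  where "delay_map T h x = (\<chi> i. h ((T ^^ card {..<i}) x))"

text \<open>
  A Borel measure on a subset \<open>X\<close> is a measure \<open>M\<close> with \<open>sets M = sets (restrict_space borel X)\<close>;
  its carrier \<open>space M\<close> is then \<open>X\<close>, and preimages under the total functions \<open>T\<close>, \<open>\<phi>\<close> are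
  intersected with it.
\<close>

definition in_L2 :: "'a measure \<Rightarrow> ('a \<Rightarrow> 'b :: {second_countable_topology, real_normed_vector}) \<Rightarrow> bool"
  where "in_L2 M f \<longleftrightarrow> f \<in> borel_measurable M \<and> integrable M (\<lambda>x. (norm (f x))\<^sup>2)"

definition measure_support :: "('a :: metric_space) measure \<Rightarrow> 'a set"
  where "measure_support M = {y. \<forall>\<epsilon>>0. emeasure M (ball y \<epsilon>) > 0}"

definition invariant_measure :: "'a measure \<Rightarrow> ('a \<Rightarrow> 'a) \<Rightarrow> bool"
  where "invariant_measure M T \<longleftrightarrow> T \<in> measurable M M \<and> distr M M T = M"

definition phi_ball :: "'a measure \<Rightarrow> ('a \<Rightarrow> 'b :: metric_space) \<Rightarrow> real \<Rightarrow> 'b \<Rightarrow> 'a set"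
  where "phi_ball M \<phi> \<epsilon> y = \<phi> -` ball y \<epsilon> \<inter> space M"

definition pred_mean ::
    "'a measure \<Rightarrow> ('a \<Rightarrow> 'a) \<Rightarrow> ('a \<Rightarrow> 'b :: euclidean_space) \<Rightarrow> real \<Rightarrow> 'b \<Rightarrow> 'b"  (\<open>\<chi>\<^sub>p\<close>)
  where "\<chi>\<^sub>p M T \<phi> \<epsilon> y =
    (1 / measure M (phi_ball M \<phi> \<epsilon> y)) *\<^sub>R (LINT x:phi_ball M \<phi> \<epsilon> y|M. \<phi> (T x))"

definition pred_error ::
    "'a measure \<Rightarrow> ('a \<Rightarrow> 'a) \<Rightarrow> ('a \<Rightarrow> 'b :: euclidean_space) \<Rightarrow> real \<Rightarrow> 'b \<Rightarrow> real"  (\<open>\<sigma>\<^sub>p\<close>)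
  where "\<sigma>\<^sub>p M T \<phi> \<epsilon> y =
    sqrt (1 / measure M (phi_ball M \<phi> \<epsilon> y) *
      (LINT x:phi_ball M \<phi> \<epsilon> y|M. (norm (\<phi> (T x) - \<chi>\<^sub>p M T \<phi> \<epsilon> y))\<^sup>2))"

text \<open>
  Bochner integrals and division are total in HOL, so the proviso under which \<open>\<chi>\<^sub>p\<close> and \<open>\<sigma>\<^sub>p\<close> are
  meaningful is a separate predicate.
\<close>
definition pred_error_exists ::
    "'a measure \<Rightarrow> ('a \<Rightarrow> 'a) \<Rightarrow> ('a \<Rightarrow> 'b :: euclidean_space) \<Rightarrow> real \<Rightarrow> 'b \<Rightarrow> bool"
  where "pred_error_exists M T \<phi> \<epsilon> y \<longleftrightarrow>
    measure M (phi_ball M \<phi> \<epsilon> y) > 0 \<and>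
    set_integrable M (phi_ball M \<phi> \<epsilon> y) (\<lambda>x. \<phi> (T x)) \<and>
    set_integrable M (phi_ball M \<phi> \<epsilon> y) (\<lambda>x. (norm (\<phi> (T x) - \<chi>\<^sub>p M T \<phi> \<epsilon> y))\<^sup>2)"

definition predictable_point ::
    "'a measure \<Rightarrow> ('a \<Rightarrow> 'a) \<Rightarrow> ('a \<Rightarrow> 'b :: euclidean_space) \<Rightarrow> 'b \<Rightarrow> bool"
  where "predictable_point M T \<phi> y \<longleftrightarrow>
    y \<in> measure_support (distr M borel \<phi>) \<and>
    (\<forall>\<^sub>F \<epsilon> in at_right 0. pred_error_exists M T \<phi> \<epsilon> y) \<and>
    ((\<lambda>\<epsilon>. \<sigma>\<^sub>p M T \<phi> \<epsilon> y) \<longlongrightarrow> 0) (at_right 0)"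

definition as_predictable ::
    "'a measure \<Rightarrow> ('a \<Rightarrow> 'a) \<Rightarrow> ('a \<Rightarrow> 'b :: euclidean_space) \<Rightarrow> bool"
  where "as_predictable M T \<phi> \<longleftrightarrow> (AE y in distr M borel \<phi>. predictable_point M T \<phi> y)"

definition full_measure_set :: "'a measure \<Rightarrow> 'a set \<Rightarrow> bool"
  where "full_measure_set M A \<longleftrightarrow> A \<in> sets M \<and> space M - A \<in> null_sets M"

definition as_det_predictable :: "'a measure \<Rightarrow> ('a \<Rightarrow> 'a) \<Rightarrow> ('a \<Rightarrow> 'b) \<Rightarrow> bool"
  where "as_det_predictable M T \<phi> \<longleftrightarrow>
    (\<exists>Xh. full_measure_set M Xh \<and>
      (\<forall>x1\<in>Xh. \<forall>x2\<in>Xh. \<phi> x1 = \<phi> x2 \<longrightarrow> \<phi> (T x1) = \<phi> (T x2)))"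

text \<open>
  The prediction map \<open>S\<close> is only meaningful on \<open>\<phi> ` Xh\<close>, a Borel set of full push-forward
  measure; the values of the total function \<open>S\<close> elsewhere are arbitrary.
\<close>
definition prediction_map ::
    "'a measure \<Rightarrow> ('a \<Rightarrow> 'a) \<Rightarrow> ('a \<Rightarrow> 'b :: euclidean_space) \<Rightarrow> 'a set \<Rightarrow> ('b \<Rightarrow> 'b) \<Rightarrow> bool"
  where "prediction_map M T \<phi> Xh S \<longleftrightarrow>
    full_measure_set M Xh \<and>
    \<phi> ` Xh \<in> sets borel \<and>
    S \<in> borel_measurable (restrict_space borel (\<phi> ` Xh)) \<and>
    S \<in> \<phi> ` Xh \<rightarrow> \<phi> ` space M \<and>
    (\<forall>x\<in>Xh. \<phi> (T x) = S (\<phi> x))"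

end

theory Submission
  imports Defs
begin

text \<open>
  Let \<open>\<nu>\<close> be the push-forward of \<open>\<mu>\<close> under \<open>\<phi>\<close>. The variance identity
  \<open>\<sigma>\<^sub>\<epsilon>(y)\<^sup>2 = avg \<parallel>\<phi> \<circ> T\<parallel>\<^sup>2 - \<parallel>\<chi>\<^sub>\<epsilon>(y)\<parallel>\<^sup>2\<close>, with averages over \<open>\<phi>\<close>-preimages of balls,
  reduces everything to the differentiation theorem for the finite Borel measure \<open>\<nu>\<close>: for
  \<open>\<nu>\<close>-almost every \<open>y\<close> the limit of \<open>\<sigma>\<^sub>\<epsilon>(y)\<^sup>2\<close> is the conditional variance of \<open>\<phi> \<circ> T\<close> given
  \<open>\<phi> = y\<close>. It vanishes almost everywhere if and only if \<open>\<phi> \<circ> T\<close> is almost surely a function of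
  \<open>\<phi>\<close>. As \<open>\<nu>\<close> need not be doubling, the maximal inequality rests on a Besicovitch covering
  argument.
\<close>

text \<open>A Vitali selection would enlarge the balls and lose control of their mass; the
  Besicovitch selection keeps the radii and pays with an overlap bounded by a constant of the space.

  Conditioning on \<open>\<phi>\<close> takes place on the target space: for
  \<open>F \<ge> 0\<close> the measure with density \<open>F\<close> against \<open>\<mu>\<close> is
  pushed forward by \<open>\<phi>\<close> and differentiated with respect to \<open>\<nu>\<close>.
  The conditional expectation thereby becomes a Borel function on the target, as both ball averages
  and a factorization \<open>\<phi> (T x) = G (\<phi> x)\<close> require.

  Compactness of the state space enters through boundedness of \<open>h\<close>, which supplies
  square integrability. A separate difficulty is measurability of the prediction map: a continuous
  image of a Borel set may fail to be Borel, and inner regularity by compact sets circumvents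
  this.\<close>

section \<open>Besicovitch selection of balls\<close>

text \<open>A finite cover of \<open>S\<close> by balls of radius \<open>q/2\<close> is fixed before
  \<open>P\<close>. Two points in one such ball are closer than \<open>q\<close>, so each ball holds
  at most one point of \<open>P\<close>. Uniformity in \<open>P\<close> is what later yields a
  constant depending on the space alone.\<close>

lemma separated_card_bound:
  fixes S :: "'a::metric_space set"
  assumes "compact S" "0 < q"
  shows "\<exists>N. \<forall>P\<subseteq>S. pairwise (\<lambda>x y. q \<le> dist x y) P \<longrightarrow> finite P \<and> card P \<le> N"
proof -
  have "S \<subseteq> (\<Union>x\<in>S. ball x (q/2))" using assms(2) by auto
  then obtain K where K: "K \<subseteq> S" "finite K" "S \<subseteq> (\<Union>x\<in>K. ball x (q/2))"
    using compactE_image[OF assms(1), of S "\<lambda>x. ball x (q/2)"] by (metis open_ball)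
  show ?thesis
  proof (intro exI[of _ "card K"] allI impI)
    fix P assume P: "P \<subseteq> S" "pairwise (\<lambda>x y. q \<le> dist x y) P"
    have "\<forall>x\<in>P. \<exists>c. c \<in> K \<and> dist c x < q/2" using P(1) K(3) by force
    from bchoice[OF this] obtain c where c: "\<And>x. x \<in> P \<Longrightarrow> c x \<in> K"
      "\<And>x. x \<in> P \<Longrightarrow> dist (c x) x < q/2" by blast
    have "inj_on c P"
    proof (rule inj_onI, rule ccontr)
      fix x y assume xy: "x \<in> P" "y \<in> P" "c x = c y" "x \<noteq> y"
      then have "q \<le> dist x y" using P(2) by (auto dest: pairwiseD)
      then show False using xy c(2)[of x] c(2)[of y] dist_triangle3[of x y "c x"] by simp
    qed
    moreover have "c ` P \<subseteq> K" using c(1) by blast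
    ultimately show "finite P \<and> card P \<le> card K"
      using K(2) card_inj_on_le inj_on_finite by blast
  qed
qed

text \<open>A separated subset of greatest cardinality works, since a point outside all its balls
  could be added. Such a subset exists because the compact closure of \<open>A\<close> bounds all
  cardinalities.\<close>

lemma maximal_separated_subset:
  fixes A :: "'a::heine_borel set"
  assumes "bounded A" "0 < q"
  shows "\<exists>P\<subseteq>A. finite P \<and> pairwise (\<lambda>x y. q \<le> dist x y) P \<and> A \<subseteq> (\<Union>x\<in>P. ball x q)"
proof -
  have "compact (closure A)" using assms(1) by (simp add: compact_closure)
  then obtain N where N: "\<And>P. P \<subseteq> closure A \<Longrightarrow> pairwise (\<lambda>x y. q \<le> dist x y) P
    \<Longrightarrow> finite P \<and> card P \<le> N"
    using separated_card_bound[OF _ assms(2), of "closure A"] by auto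
  define sep where "sep P \<longleftrightarrow> P \<subseteq> A \<and> pairwise (\<lambda>x y. q \<le> dist x y) P" for P
  have b: "finite P \<and> card P \<le> N" if "sep P" for P
  proof (rule N)
    show "P \<subseteq> closure A" using that closure_subset[of A] unfolding sep_def by blast
  qed (use that in \<open>simp add: sep_def\<close>)
  have "sep {}" by (simp add: sep_def)
  moreover have "\<forall>P. sep P \<longrightarrow> card P < Suc N" using b by (auto simp: less_Suc_eq_le)
  ultimately obtain P where P: "sep P" "\<And>P'. sep P' \<Longrightarrow> card P' \<le> card P"
    using ex_has_greatest_nat[of sep "{}" card "Suc N"] by blast
  have "A \<subseteq> (\<Union>x\<in>P. ball x q)"
  proof (rule subsetI, rule ccontr)
    fix y assume y: "y \<in> A" "y \<notin> (\<Union>x\<in>P. ball x q)"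
    then have "y \<notin> P" using assms(2) by auto
    moreover have "sep (insert y P)"
      using P(1) y by (auto simp: sep_def pairwise_insert dist_commute not_less)
    ultimately show False using P(2)[of "insert y P"] b[OF P(1)] by simp
  qed
  then show ?thesis using P(1) b[OF P(1)] unfolding sep_def by blast
qed

text \<open>
  With finitely many radii the greedy selection can always take a largest remaining ball, so the
  centre of each selected ball lies outside every other selected ball.
\<close>
lemma besicovitch_selection:
  fixes A :: "'a::heine_borel set" and r :: "'a \<Rightarrow> real"
  assumes "finite Q" "bounded A" "\<And>q. q \<in> Q \<Longrightarrow> 0 < q" "r ` A \<subseteq> Q"
  shows "\<exists>P\<subseteq>A. finite P \<and> pairwise (\<lambda>x y. max (r x) (r y) \<le> dist x y) P \<and>
    A \<subseteq> (\<Union>x\<in>P. ball x (r x))"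
  using assms
proof (induction Q arbitrary: A rule: finite_linorder_min_induct)
  case empty
  then show ?case by auto
next
  case (insert q Q)
  \<comment> \<open>The new \<open>q\<close> lies below every radius in \<open>Q\<close>, so the
    induction hypothesis deals with exactly the larger balls.\<close>
  define A' where "A' = {y\<in>A. r y \<in> Q}"
  have "bounded A'" "r ` A' \<subseteq> Q"
    using insert.prems(1) by (auto simp: A'_def intro: bounded_subset)
  then have "\<exists>P\<subseteq>A'. finite P \<and> pairwise (\<lambda>x y. max (r x) (r y) \<le> dist x y) P \<and>
      A' \<subseteq> (\<Union>x\<in>P. ball x (r x))"
    using insert.prems(2) by (intro insert.IH) auto
  then obtain P' where P': "P' \<subseteq> A'" "finite P'"
    "pairwise (\<lambda>x y. max (r x) (r y) \<le> dist x y) P'" "A' \<subseteq> (\<Union>x\<in>P'. ball x (r x))"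
    by auto
  \<comment> \<open>Only centres missed by the larger balls receive a ball of radius
    \<open>q\<close>; this is what separates them from the earlier centres.\<close>
  define B where "B = {y\<in>A. r y = q} - (\<Union>x\<in>P'. ball x (r x))"
  have "bounded B" using insert.prems(1) by (rule bounded_subset) (auto simp: B_def)
  then obtain P where P: "P \<subseteq> B" "finite P"
    "pairwise (\<lambda>x y. q \<le> dist x y) P" "B \<subseteq> (\<Union>x\<in>P. ball x q)"
    using maximal_separated_subset[of B q] insert.prems(2) by auto
  have mixed: "max (r x) (r y) \<le> dist x y" if "x \<in> P'" "y \<in> P" for x y
  proof -
    have "y \<in> B" "r x \<in> Q" using that P(1) P'(1) by (auto simp: A'_def)
    then have "r x \<le> dist x y" "r y = q" "q < r x"
      using that(1) insert.hyps by (auto simp: B_def not_less)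
    then show ?thesis by simp
  qed
  show ?case
  proof (intro exI[of _ "P' \<union> P"] conjI)
    show "P' \<union> P \<subseteq> A" using P P' by (auto simp: B_def A'_def)
    show "finite (P' \<union> P)" using P P' by simp
    have rq: "r x = q" if "x \<in> P" for x using that P(1) by (auto simp: B_def)
    show "pairwise (\<lambda>x y. max (r x) (r y) \<le> dist x y) (P' \<union> P)"
    proof (rule pairwiseI)
      fix x y assume xy: "x \<in> P' \<union> P" "y \<in> P' \<union> P" "x \<noteq> y"
      then consider "x \<in> P'" "y \<in> P'" | "x \<in> P" "y \<in> P" | "x \<in> P'" "y \<in> P" | "x \<in> P" "y \<in> P'"
        by blast
      then show "max (r x) (r y) \<le> dist x y"
      proof cases
        case 1
        then show ?thesis using xy P'(3) by (auto dest: pairwiseD)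
      next
        case 2
        then show ?thesis using xy P(3) rq by (auto dest: pairwiseD)
      next
        case 3
        then show ?thesis by (rule mixed)
      next
        case 4
        then show ?thesis using mixed[of y x] by (simp add: dist_commute max.commute)
      qed
    qed
    show "A \<subseteq> (\<Union>x\<in>P' \<union> P. ball x (r x))"
    proof
      fix y assume "y \<in> A"
      then have "y \<in> A' \<or> y \<in> B \<or> y \<in> (\<Union>x\<in>P'. ball x (r x))"
        using insert.prems(3) by (auto simp: A'_def B_def)
      moreover have "(\<Union>x\<in>P. ball x q) = (\<Union>x\<in>P. ball x (r x))" using rq by simp
      ultimately show "y \<in> (\<Union>x\<in>P' \<union> P. ball x (r x))"
        unfolding UN_Un using subsetD[OF P(4), of y] subsetD[OF P'(4), of y] by auto
    qed
  qed
qed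

text \<open>
  Seen from a common point of two such balls, the directions of their centres differ by an angle of
  at least 60 degrees.
\<close>
lemma separated_directions:
  fixes a b :: "'a::real_normed_vector"
  assumes "a \<noteq> 0" "b \<noteq> 0" "norm a \<le> dist a b" "norm b \<le> dist a b"
  shows "1 \<le> dist (sgn a) (sgn b)"
proof -
  have *: "1 \<le> dist (sgn a) (sgn b)"
    if "a \<noteq> 0" "b \<noteq> 0" "norm a \<le> dist a b" "norm b \<le> norm a" for a b :: 'a
  proof -
    \<comment> \<open>The first summand is radial of length \<open>norm a - norm b\<close>; the
      second joins two vectors of length \<open>norm b\<close>. Since \<open>dist a b\<close> is at
      least \<open>norm a\<close>, the second must contribute at least
      \<open>norm b\<close>.\<close>
    have "a - b = (norm a - norm b) *\<^sub>R sgn a + norm b *\<^sub>R (sgn a - sgn b)"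
      using that by (simp add: algebra_simps sgn_div_norm)
    then have "dist a b \<le> (norm a - norm b) + norm b * dist (sgn a) (sgn b)"
      using that norm_triangle_ineq[of "(norm a - norm b) *\<^sub>R sgn a" "norm b *\<^sub>R (sgn a - sgn b)"]
      by (simp add: dist_norm norm_sgn)
    then have "norm b * 1 \<le> norm b * dist (sgn a) (sgn b)" using that(3) by linarith
    then show ?thesis using that(2) by (metis mult_le_cancel_left_pos zero_less_norm_iff)
  qed
  show ?thesis
    using *[of a b] *[of b a] assms by (cases "norm b \<le> norm a") (auto simp: dist_commute)
qed

text \<open>Seen from \<open>z\<close>, the centres of the balls containing \<open>z\<close> have
  1-separated directions on the unit sphere, which is compact. The bound therefore does not depend
  on \<open>P\<close>, \<open>r\<close> or \<open>z\<close>.\<close>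

lemma besicovitch_overlap:
  "\<exists>N. \<forall>P r (z::'a::euclidean_space). finite P \<longrightarrow> pairwise (\<lambda>x y. max (r x) (r y) \<le> dist x y) P \<longrightarrow>
    card {x\<in>P. z \<in> ball x (r x)} \<le> N"
proof -
  obtain N where N: "\<And>P. P \<subseteq> sphere (0::'a) 1 \<Longrightarrow> pairwise (\<lambda>x y. 1 \<le> dist x y) P
    \<Longrightarrow> finite P \<and> card P \<le> N"
    using separated_card_bound[of "sphere (0::'a) 1" 1] by auto
  show ?thesis
  \<comment> \<open>The extra 1 accounts for \<open>z\<close>, which may itself be a centre but then
    has no direction.\<close>
  proof (intro exI[of _ "N + 1"] allI impI)
    fix P :: "'a set" and r z
    assume P: "finite P" "pairwise (\<lambda>x y. max (r x) (r y) \<le> dist x y) P"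
    define C where "C = {x\<in>P. z \<in> ball x (r x)} - {z}"
    have sep: "1 \<le> dist (sgn (x - z)) (sgn (y - z))" if "x \<in> C" "y \<in> C" "x \<noteq> y" for x y
    proof (rule separated_directions)
      have "max (r x) (r y) \<le> dist x y" "dist x z < r x" "dist y z < r y"
        using that P(2) by (auto simp: C_def dest: pairwiseD)
      moreover have "dist (x - z) (y - z) = dist x y" by (simp add: dist_norm)
      ultimately show "norm (x - z) \<le> dist (x - z) (y - z)" "norm (y - z) \<le> dist (x - z) (y - z)"
        by (auto simp: dist_norm)
    qed (use that in \<open>auto simp: C_def\<close>)
    have "inj_on (\<lambda>x. sgn (x - z)) C"
    proof (rule inj_onI, rule ccontr)
      fix x y assume "x \<in> C" "y \<in> C" "sgn (x - z) = sgn (y - z)" "x \<noteq> y"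
      then show False using sep[of x y] by simp
    qed
    then have "card C = card ((\<lambda>x. sgn (x - z)) ` C)" by (simp add: card_image)
    also have "\<dots> \<le> N"
    proof (rule N[THEN conjunct2])
      show "(\<lambda>x. sgn (x - z)) ` C \<subseteq> sphere 0 1" by (auto simp: C_def norm_sgn split: if_splits)
      show "pairwise (\<lambda>x y. 1 \<le> dist x y) ((\<lambda>x. sgn (x - z)) ` C)"
        using sep by (auto simp: pairwise_def)
    qed
    finally have "card C \<le> N" .
    moreover have "card {x\<in>P. z \<in> ball x (r x)} \<le> card (insert z C)"
      by (rule card_mono) (auto simp: C_def P(1))
    moreover have "card (insert z C) \<le> Suc (card C)" by (rule card_insert_le_m1) auto
    ultimately show "card {x\<in>P. z \<in> ball x (r x)} \<le> N + 1" by linarith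
  qed
qed

section \<open>The maximal inequality\<close>

lemma borel_ball_graph [measurable]:
  "{p. snd p \<in> ball (fst p) q} \<in> sets (borel \<Otimes>\<^sub>M (borel :: 'a::euclidean_space measure))"
proof -
  have "{p::'a\<times>'a. snd p \<in> ball (fst p) q} = {p \<in> space (borel \<Otimes>\<^sub>M borel). dist (fst p) (snd p) < q}"
    by (auto simp: space_pair_measure)
  also have "\<dots> \<in> sets (borel \<Otimes>\<^sub>M borel)" by measurable
  finally show ?thesis .
qed

text \<open>A ball with moving centre is a section of one Borel subset of the product, so
  measurability of parameter integrals applies.\<close>

lemma measurable_nn_integral_ball [measurable]:
  fixes \<nu> :: "'a::euclidean_space measure"
  assumes "finite_measure \<nu>" and [measurable_cong]: "sets \<nu> = sets borel"
    and [measurable]: "g \<in> borel_measurable borel"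
  shows "(\<lambda>y. \<integral>\<^sup>+z\<in>ball y q. g z \<partial>\<nu>) \<in> borel_measurable borel"
proof -
  interpret finite_measure \<nu> by fact
  have "(\<lambda>y. \<integral>\<^sup>+z. g z * indicator {p. snd p \<in> ball (fst p) q} (y, z) \<partial>\<nu>) \<in> borel_measurable borel"
    by measurable
  then show ?thesis by (simp add: indicator_def)
qed

text \<open>Weak type estimate for the centred maximal function; products in place of quotients
  spare the case of null balls. The selection needs bounded centres and finitely many radii, so
  \<open>E\<close> is exhausted by sets \<open>A m\<close> with both properties, and the estimate
  passes to their union by continuity from below.\<close>

lemma maximal_inequality:
  "\<exists>C::nat. \<forall>(\<nu>::'a::euclidean_space measure) g c. finite_measure \<nu> \<longrightarrow> sets \<nu> = sets borel \<longrightarrow>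
    g \<in> borel_measurable borel \<longrightarrow>
    (\<exists>E\<in>sets \<nu>. c * emeasure \<nu> E \<le> of_nat C * (\<integral>\<^sup>+z. g z \<partial>\<nu>) \<and>
      (\<forall>y r. y \<notin> E \<longrightarrow> 0 < r \<longrightarrow> (\<integral>\<^sup>+z\<in>ball y r. g z \<partial>\<nu>) \<le> c * emeasure \<nu> (ball y r)))"
proof -
  obtain C where *: "\<forall>P r (z::'a). finite P \<longrightarrow> pairwise (\<lambda>x y. max (r x) (r y) \<le> dist x y) P \<longrightarrow>
    card {x\<in>P. z \<in> ball x (r x)} \<le> C"
    using besicovitch_overlap by (rule exE)
  have C: "card {x\<in>P. z \<in> ball x (r x)} \<le> C"
    if "finite P" "pairwise (\<lambda>x y. max (r x) (r y) \<le> dist x y) P" for P r and z :: 'a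
    using * that by auto
  show ?thesis
  proof (intro exI[of _ C] allI impI)
    fix \<nu> :: "'a measure" and g :: "'a \<Rightarrow> ennreal" and c :: ennreal
    assume fin: "finite_measure \<nu>" and sets_nu [measurable_cong]: "sets \<nu> = sets borel"
      and g [measurable]: "g \<in> borel_measurable borel"
    interpret finite_measure \<nu> by (rule fin)
    define bad where "bad q y \<longleftrightarrow> c * emeasure \<nu> (ball y q) < (\<integral>\<^sup>+z\<in>ball y q. g z \<partial>\<nu>)" for q y
    have bad_borel: "{y. bad q y} \<in> sets borel" for q
    proof -
      have [measurable]: "(\<lambda>y. emeasure \<nu> (ball y q)) \<in> borel_measurable borel"
        using measurable_nn_integral_ball[OF fin sets_nu, of "\<lambda>_. 1"] by (simp add: sets_nu)
      have [measurable]: "(\<lambda>y. \<integral>\<^sup>+z\<in>ball y q. g z \<partial>\<nu>) \<in> borel_measurable borel"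
        using measurable_nn_integral_ball[OF fin sets_nu g] .
      show ?thesis unfolding bad_def by measurable
    qed
    \<comment> \<open>Countably many radii keep the exceptional set measurable, and truncating their
      enumeration leaves finitely many at each stage.\<close>
    define Q where "Q = {q::real. q \<in> \<rat> \<and> 0 < q}"
    have "countable Q" unfolding Q_def by (rule countable_subset[OF _ countable_rat]) auto
    moreover have "1 \<in> Q" by (simp add: Q_def)
    ultimately have Q: "range (from_nat_into Q) = Q" by (intro range_from_nat_into) auto
    define A where "A m = {y\<in>ball 0 (real m). \<exists>n\<le>m. bad (from_nat_into Q n) y}" for m
    have A_eq: "A m = ball 0 (real m) \<inter> (\<Union>n\<le>m. {y. bad (from_nat_into Q n) y})" for m
      by (auto simp: A_def)
    have A_sets: "A m \<in> sets \<nu>" for m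
      unfolding A_eq using bad_borel by (auto simp: sets_nu)
    have A_bound: "c * emeasure \<nu> (A m) \<le> of_nat C * (\<integral>\<^sup>+z. g z \<partial>\<nu>)" for m
    proof -
      have "\<forall>y\<in>A m. \<exists>q. q \<in> from_nat_into Q ` {..m} \<and> bad q y" by (auto simp: A_def)
      from bchoice[OF this] obtain r where r: "\<And>y. y \<in> A m \<Longrightarrow> r y \<in> from_nat_into Q ` {..m}"
        "\<And>y. y \<in> A m \<Longrightarrow> bad (r y) y" by blast
      have "bounded (A m)" by (rule bounded_subset[OF bounded_ball[of 0 "real m"]]) (auto simp: A_def)
      moreover have "0 < q" if "q \<in> from_nat_into Q ` {..m}" for q using that Q unfolding Q_def by auto
      moreover have "r ` A m \<subseteq> from_nat_into Q ` {..m}" using r(1) by blast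
      ultimately have "\<exists>P\<subseteq>A m. finite P \<and> pairwise (\<lambda>x y. max (r x) (r y) \<le> dist x y) P \<and>
          A m \<subseteq> (\<Union>x\<in>P. ball x (r x))"
        by (intro besicovitch_selection) auto
      then obtain P where P: "P \<subseteq> A m" "finite P"
        "pairwise (\<lambda>x y. max (r x) (r y) \<le> dist x y) P" "A m \<subseteq> (\<Union>x\<in>P. ball x (r x))"
        by auto
      have "c * emeasure \<nu> (A m) \<le> c * (\<Sum>x\<in>P. emeasure \<nu> (ball x (r x)))"
        by (intro mult_left_mono order_trans[OF emeasure_mono[OF P(4)]] emeasure_subadditive_finite P)
          (auto simp: sets_nu P(2) intro!: borel_open open_UN)
      also have "\<dots> \<le> (\<Sum>x\<in>P. \<integral>\<^sup>+z\<in>ball x (r x). g z \<partial>\<nu>)"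
        unfolding sum_distrib_left
      proof (rule sum_mono)
        fix x assume "x \<in> P"
        then have "bad (r x) x" using P(1) r(2) by blast
        then show "c * emeasure \<nu> (ball x (r x)) \<le> (\<integral>\<^sup>+z\<in>ball x (r x). g z \<partial>\<nu>)"
          unfolding bad_def by simp
      qed
      also have "\<dots> = (\<integral>\<^sup>+z. (\<Sum>x\<in>P. g z * indicator (ball x (r x)) z) \<partial>\<nu>)"
        by (rule nn_integral_sum[symmetric]) (measurable, simp add: sets_nu)
      also have "\<dots> \<le> (\<integral>\<^sup>+z. of_nat C * g z \<partial>\<nu>)"
      proof (rule nn_integral_mono)
        \<comment> \<open>Bounded overlap: at most \<open>C\<close> of the summands are nonzero at
          \<open>z\<close>.\<close>
        fix z
        have "(\<Sum>x\<in>P. g z * indicator (ball x (r x)) z) = (\<Sum>x\<in>{x\<in>P. z \<in> ball x (r x)}. g z)"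
          by (rule sum.mono_neutral_cong_right) (auto simp: P(2))
        also have "\<dots> = of_nat (card {x\<in>P. z \<in> ball x (r x)}) * g z" by simp
        also have "\<dots> \<le> of_nat C * g z"
          using C[OF P(2,3)] by (intro mult_right_mono) auto
        finally show "(\<Sum>x\<in>P. g z * indicator (ball x (r x)) z) \<le> of_nat C * g z" .
      qed
      also have "\<dots> = of_nat C * (\<integral>\<^sup>+z. g z \<partial>\<nu>)" by (rule nn_integral_cmult) measurable
      finally show ?thesis .
    qed
    have inc: "incseq A"
    proof (rule monoI)
      fix m n :: nat assume "m \<le> n"
      then have "ball (0::'a) (real m) \<subseteq> ball 0 (real n)" "{..m} \<subseteq> {..n}" by auto
      then show "A m \<subseteq> A n" unfolding A_eq by (intro Int_mono UN_mono) auto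
    qed
    have outside: "(\<integral>\<^sup>+z\<in>ball y q. g z \<partial>\<nu>) \<le> c * emeasure \<nu> (ball y q)"
      if y: "y \<notin> (\<Union>m. A m)" and q: "q \<in> Q" for y q
    proof (rule ccontr)
      assume "\<not> ?thesis"
      then have "bad q y" by (simp add: bad_def)
      then obtain n where n: "bad (from_nat_into Q n) y" using q Q by (metis rangeE)
      obtain l where "norm y < real l" using reals_Archimedean2 by blast
      then have "y \<in> A (max n l)" using n by (auto simp: A_def intro!: exI[of _ n])
      then show False using y by blast
    qed
    show "\<exists>E\<in>sets \<nu>. c * emeasure \<nu> E \<le> of_nat C * (\<integral>\<^sup>+z. g z \<partial>\<nu>) \<and>
      (\<forall>y r. y \<notin> E \<longrightarrow> 0 < r \<longrightarrow> (\<integral>\<^sup>+z\<in>ball y r. g z \<partial>\<nu>) \<le> c * emeasure \<nu> (ball y r))"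
    proof (intro bexI[of _ "\<Union>m. A m"] conjI allI impI)
      show "(\<Union>m. A m) \<in> sets \<nu>" using A_sets by blast
      have "range A \<subseteq> sets \<nu>" using A_sets by blast
      then have "c * emeasure \<nu> (\<Union>m. A m) = c * (SUP m. emeasure \<nu> (A m))"
        using SUP_emeasure_incseq[OF _ inc, of \<nu>] by simp
      also have "\<dots> = (SUP m. c * emeasure \<nu> (A m))" by (simp add: SUP_mult_left_ennreal)
      also have "\<dots> \<le> of_nat C * (\<integral>\<^sup>+z. g z \<partial>\<nu>)" by (intro SUP_least A_bound)
      finally show "c * emeasure \<nu> (\<Union>m. A m) \<le> of_nat C * (\<integral>\<^sup>+z. g z \<partial>\<nu>)" .
    next
      fix y and r :: real assume y: "y \<notin> (\<Union>m. A m)" and r: "0 < r"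
      \<comment> \<open>\<open>u 0 = 0\<close> and \<open>u n\<close> increases to \<open>r\<close>,
        so a positive rational fits strictly between \<open>u n\<close> and \<open>r\<close>.
        Viewing the integral as the measure \<open>G\<close> lets continuity from below carry the
        estimate from rational radii to \<open>r\<close>.\<close>
      define u where "u n = r - r / real (Suc n)" for n
      define G where "G = density \<nu> g"
      have G: "emeasure G (ball y s) = (\<integral>\<^sup>+z\<in>ball y s. g z \<partial>\<nu>)" for s
        unfolding G_def by (rule emeasure_density) (auto simp: sets_nu cong: measurable_cong_sets)
      have u: "0 \<le> u n" "u n < r" for n using r by (auto simp: u_def field_simps)
      have "mono u" unfolding u_def using r by (intro monoI diff_left_mono divide_left_mono) auto
      then have inc_u: "incseq (\<lambda>n. ball y (u n))" by (intro monoI) (auto dest: monoD)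
      have ball_eq: "ball y r = (\<Union>n. ball y (u n))"
      proof (intro set_eqI iffI)
        fix z assume "z \<in> ball y r"
        then have "0 < (r - dist y z) / r" using r by simp
        then obtain n where "inverse (real (Suc n)) < (r - dist y z) / r" using reals_Archimedean by blast
        then have "r * inverse (real (Suc n)) < r - dist y z"
          using r by (simp only: pos_less_divide_eq mult.commute)
        then show "z \<in> (\<Union>n. ball y (u n))" by (auto simp: u_def divide_inverse intro!: exI[of _ n])
      next
        fix z assume "z \<in> (\<Union>n. ball y (u n))"
        then obtain n where "dist y z < u n" by auto
        then show "z \<in> ball y r" using u(2)[of n] by simp
      qed
      have "emeasure G (ball y r) = (SUP n. emeasure G (ball y (u n)))"
        unfolding ball_eq by (rule SUP_emeasure_incseq[symmetric, OF _ inc_u]) (auto simp: G_def sets_nu)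
      also have "\<dots> \<le> c * emeasure \<nu> (ball y r)"
      proof (rule SUP_least)
        fix n
        obtain q where q: "q \<in> \<rat>" "u n < q" "q < r" using Rats_dense_in_real[OF u(2)[of n]] by blast
        then have "q \<in> Q" using u(1)[of n] by (simp add: Q_def)
        have "emeasure G (ball y (u n)) \<le> emeasure G (ball y q)"
          using q by (intro emeasure_mono subset_ball) (auto simp: G_def sets_nu)
        also have "\<dots> \<le> c * emeasure \<nu> (ball y q)" unfolding G by (rule outside[OF y \<open>q \<in> Q\<close>])
        also have "\<dots> \<le> c * emeasure \<nu> (ball y r)"
          using q by (intro mult_left_mono emeasure_mono subset_ball) (auto simp: sets_nu)
        finally show "emeasure G (ball y (u n)) \<le> c * emeasure \<nu> (ball y r)" .
      qed
      finally show "(\<integral>\<^sup>+z\<in>ball y r. g z \<partial>\<nu>) \<le> c * emeasure \<nu> (ball y r)" unfolding G .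
    qed
  qed
qed

section \<open>Differentiation of integrals over balls\<close>

text \<open>The complement of the support is covered by the null members of a countable
  base.\<close>

lemma AE_in_measure_support:
  fixes \<nu> :: "'a::{metric_space, second_countable_topology} measure"
  assumes "sets \<nu> = sets borel"
  shows "AE y in \<nu>. y \<in> measure_support \<nu>"
proof -
  obtain B :: "'a set set" where B: "countable B" "topological_basis B"
    using ex_countable_basis by blast
  have B_sets: "b \<in> sets \<nu>" if "b \<in> B" for b
    using B(2) that assms by (simp add: topological_basis_open)
  have "(\<Union>b\<in>{b\<in>B. emeasure \<nu> b = 0}. b) \<in> null_sets \<nu>"
    using B(1) B_sets by (intro null_sets_UN') (auto intro: countable_subset)
  then show ?thesis
  proof (rule AE_I', intro subsetI)
    fix y assume "y \<in> {y \<in> space \<nu>. y \<notin> measure_support \<nu>}"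
    then obtain \<epsilon> where \<epsilon>: "0 < \<epsilon>" "emeasure \<nu> (ball y \<epsilon>) = 0" by (auto simp: measure_support_def)
    then obtain b where b: "b \<in> B" "y \<in> b" "b \<subseteq> ball y \<epsilon>"
      using topological_basisE[OF B(2), of "ball y \<epsilon>" y] by (metis centre_in_ball open_ball)
    have "emeasure \<nu> b \<le> emeasure \<nu> (ball y \<epsilon>)" by (rule emeasure_mono[OF b(3)]) (simp add: assms)
    then show "y \<in> (\<Union>b\<in>{b\<in>B. emeasure \<nu> b = 0}. b)" using b \<epsilon> by auto
  qed
qed

definition ball_avg :: "'a::metric_space measure \<Rightarrow> ('a \<Rightarrow> real) \<Rightarrow> real \<Rightarrow> 'a \<Rightarrow> real"
  where "ball_avg \<nu> f r y = (LINT z:ball y r|\<nu>. f z) / measure \<nu> (ball y r)"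

locale finite_borel_measure = finite_measure \<nu> for \<nu> :: "'a::euclidean_space measure" +
  assumes sets_eq [measurable_cong]: "sets \<nu> = sets borel"
begin

lemma space_eq [simp]: "space \<nu> = UNIV"
  using sets_eq_imp_space_eq[OF sets_eq] by simp

lemma ball_sets [simp]: "ball y r \<in> sets \<nu>"
  by (simp add: sets_eq)

lemma measure_ball_pos: "y \<in> measure_support \<nu> \<Longrightarrow> 0 < r \<Longrightarrow> 0 < measure \<nu> (ball y r)"
  by (auto simp: measure_support_def emeasure_eq_measure)

lemma set_integrable_ball: "integrable \<nu> f \<Longrightarrow> set_integrable \<nu> (ball y r) f"
  for f :: "'a \<Rightarrow> 'b::{banach, second_countable_topology}"
  unfolding set_integrable_def by (rule integrable_mult_indicator) auto

lemma ball_avg_add: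
  assumes "integrable \<nu> f" "integrable \<nu> g"
  shows "ball_avg \<nu> (\<lambda>z. f z + g z) r y = ball_avg \<nu> f r y + ball_avg \<nu> g r y"
  unfolding ball_avg_def using assms[THEN set_integrable_ball] by (simp add: add_divide_distrib)

lemma ball_avg_const:
  assumes "y \<in> measure_support \<nu>" "0 < r"
  shows "ball_avg \<nu> (\<lambda>z. c) r y = c"
  using measure_ball_pos[OF assms] by (simp add: ball_avg_def set_integral_const emeasure_eq_measure)

lemma ball_avg_diff_le:
  assumes "integrable \<nu> f" "integrable \<nu> g"
  shows "\<bar>ball_avg \<nu> f r y - ball_avg \<nu> g r y\<bar> \<le> ball_avg \<nu> (\<lambda>z. \<bar>f z - g z\<bar>) r y"
proof -
  have "ball_avg \<nu> f r y - ball_avg \<nu> g r y = (LINT z:ball y r|\<nu>. f z - g z) / measure \<nu> (ball y r)"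
    unfolding ball_avg_def using assms[THEN set_integrable_ball] by (simp add: diff_divide_distrib)
  moreover have "\<bar>LINT z:ball y r|\<nu>. f z - g z\<bar> \<le> (LINT z:ball y r|\<nu>. \<bar>f z - g z\<bar>)"
    using integral_norm_bound[of \<nu> "\<lambda>z. indicator (ball y r) z *\<^sub>R (f z - g z)"]
    by (simp add: set_lebesgue_integral_def abs_mult)
  ultimately show ?thesis
    unfolding ball_avg_def by (simp add: abs_divide divide_right_mono)
qed

text \<open>On a null ball the average is \<open>0\<close> by division by zero;
  \<open>0 \<le> c\<close> covers that case.\<close>

lemma ball_avg_le:
  assumes "integrable \<nu> f" "(LINT z:ball y r|\<nu>. f z) \<le> c * measure \<nu> (ball y r)" "0 \<le> c"
  shows "ball_avg \<nu> f r y \<le> c"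
  using assms by (cases "measure \<nu> (ball y r) = 0") (auto simp: ball_avg_def zero_less_measure_iff field_simps)

text \<open>Continuous functions form the class where differentiation is immediate; the maximal
  inequality extends it from there.\<close>

lemma ball_avg_tendsto_continuous:
  assumes "continuous_on UNIV f" "integrable \<nu> f" "y \<in> measure_support \<nu>"
  shows "((\<lambda>r. ball_avg \<nu> f r y) \<longlongrightarrow> f y) (at_right 0)"
proof (rule tendstoI)
  fix e :: real assume "0 < e"
  moreover have "isCont f y" using assms(1) by (simp add: continuous_on_eq_continuous_at)
  ultimately obtain d where d: "0 < d" "\<And>z. dist z y < d \<Longrightarrow> dist (f z) (f y) < e / 2"
    unfolding continuous_at_eps_delta by (meson half_gt_zero)
  have close: "dist (ball_avg \<nu> f r y) (f y) < e" if r: "0 < r" "r < d" for r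
  proof -
    have int: "integrable \<nu> (\<lambda>z. \<bar>f z - f y\<bar>)" using assms(2) by simp
    have "\<bar>ball_avg \<nu> f r y - f y\<bar> \<le> ball_avg \<nu> (\<lambda>z. \<bar>f z - f y\<bar>) r y"
      using ball_avg_diff_le[OF assms(2), of "\<lambda>_. f y" r y] ball_avg_const[OF assms(3) r(1)] by simp
    also have "\<dots> \<le> e / 2"
    proof (rule ball_avg_le[OF int])
      have "(LINT z:ball y r|\<nu>. \<bar>f z - f y\<bar>) \<le> (LINT z:ball y r|\<nu>. e / 2)"
      proof (rule set_integral_mono)
        show "\<bar>f z - f y\<bar> \<le> e / 2" if "z \<in> ball y r" for z
          using d(2)[of z] that r by (simp add: dist_real_def dist_commute)
      qed (use int in \<open>auto intro: set_integrable_ball\<close>)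
      then show "(LINT z:ball y r|\<nu>. \<bar>f z - f y\<bar>) \<le> e / 2 * measure \<nu> (ball y r)"
        by (simp add: set_integral_const emeasure_eq_measure mult.commute)
    qed (use \<open>0 < e\<close> in simp)
    finally show ?thesis using \<open>0 < e\<close> by (simp add: dist_real_def)
  qed
  show "\<forall>\<^sub>F r in at_right 0. dist (ball_avg \<nu> f r y) (f y) < e"
    unfolding eventually_at_right_field using d(1) close by blast
qed

text \<open>The error at \<open>y\<close> splits into the average of
  \<open>\<bar>f - s n\<bar>\<close>, the differentiation error of \<open>s n\<close>, and
  \<open>\<bar>s n y - f y\<bar>\<close>. The maximal inequality controls the first and Markov's
  inequality the third, each outside a set of measure at most a constant times the \<open>L1\<close>
  distance; the second tends to \<open>0\<close> almost everywhere. The factor 3 in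
  \<open>AE_close\<close> counts these terms.\<close>

lemma differentiation_L1_limit:
  assumes f: "integrable \<nu> f" and s: "\<And>n. integrable \<nu> (s n)"
    and diff: "\<And>n. AE y in \<nu>. ((\<lambda>r. ball_avg \<nu> (s n) r y) \<longlongrightarrow> s n y) (at_right 0)"
    and L1: "(\<lambda>n. \<integral>z. \<bar>f z - s n z\<bar> \<partial>\<nu>) \<longlonglongrightarrow> 0"
  shows "AE y in \<nu>. ((\<lambda>r. ball_avg \<nu> f r y) \<longlongrightarrow> f y) (at_right 0)"
proof -
  define I where "I n = (\<integral>z. \<bar>f z - s n z\<bar> \<partial>\<nu>)" for n
  have int: "integrable \<nu> (\<lambda>z. \<bar>f z - s n z\<bar>)" for n using f s by auto
  note [measurable] = borel_measurable_integrable[OF f] borel_measurable_integrable[OF s]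
  obtain C :: nat where *: "\<forall>(\<nu>::'a measure) g c. finite_measure \<nu> \<longrightarrow> sets \<nu> = sets borel \<longrightarrow>
    g \<in> borel_measurable borel \<longrightarrow>
    (\<exists>E\<in>sets \<nu>. c * emeasure \<nu> E \<le> of_nat C * (\<integral>\<^sup>+z. g z \<partial>\<nu>) \<and>
      (\<forall>y r. y \<notin> E \<longrightarrow> 0 < r \<longrightarrow> (\<integral>\<^sup>+z\<in>ball y r. g z \<partial>\<nu>) \<le> c * emeasure \<nu> (ball y r)))"
    using maximal_inequality by (rule exE)
  have C: "\<exists>E\<in>sets \<nu>. c * emeasure \<nu> E \<le> of_nat C * (\<integral>\<^sup>+z. g z \<partial>\<nu>) \<and>
      (\<forall>y r. y \<notin> E \<longrightarrow> 0 < r \<longrightarrow> (\<integral>\<^sup>+z\<in>ball y r. g z \<partial>\<nu>) \<le> c * emeasure \<nu> (ball y r))"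
    if "g \<in> borel_measurable borel" for g c
    by (rule *[rule_format, OF finite_measure_axioms sets_eq that])
  have AE_close: "AE y in \<nu>. \<forall>\<^sub>F r in at_right 0. dist (ball_avg \<nu> f r y) (f y) < 3 * e"
    if e: "0 < e" for e :: real
  proof -
    have "\<forall>n. \<exists>E. E \<in> sets \<nu> \<and> measure \<nu> E \<le> real C * I n / e \<and>
      (\<forall>y r. y \<notin> E \<longrightarrow> 0 < r \<longrightarrow> ball_avg \<nu> (\<lambda>z. \<bar>f z - s n z\<bar>) r y \<le> e)"
    proof
      fix n
      obtain E where E: "E \<in> sets \<nu>"
        "ennreal e * emeasure \<nu> E \<le> of_nat C * (\<integral>\<^sup>+z. ennreal \<bar>f z - s n z\<bar> \<partial>\<nu>)"
        "\<And>y r. y \<notin> E \<Longrightarrow> 0 < r \<Longrightarrow>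
          (\<integral>\<^sup>+z\<in>ball y r. ennreal \<bar>f z - s n z\<bar> \<partial>\<nu>) \<le> ennreal e * emeasure \<nu> (ball y r)"
        using C[of "\<lambda>z. ennreal \<bar>f z - s n z\<bar>" "ennreal e"] by (auto simp: sets_eq cong: measurable_cong_sets)
      have "ennreal (e * measure \<nu> E) \<le> ennreal (real C * I n)"
        using E(2) e nn_integral_eq_integral[OF int[of n]]
        by (simp add: emeasure_eq_measure ennreal_mult I_def ennreal_of_nat_eq_real_of_nat)
      then have "e * measure \<nu> E \<le> real C * I n"
        by (subst (asm) ennreal_le_iff) (auto simp: I_def)
      then have "measure \<nu> E \<le> real C * I n / e" using e by (simp add: field_simps)
      moreover have "ball_avg \<nu> (\<lambda>z. \<bar>f z - s n z\<bar>) r y \<le> e" if "y \<notin> E" "0 < r" for y r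
      proof (rule ball_avg_le[OF int])
        have "(\<integral>\<^sup>+z\<in>ball y r. ennreal \<bar>f z - s n z\<bar> \<partial>\<nu>) = (\<integral>\<^sup>+z. ennreal (indicator (ball y r) z *\<^sub>R \<bar>f z - s n z\<bar>) \<partial>\<nu>)"
          by (intro nn_integral_cong) (simp add: indicator_def)
        also have "\<dots> = ennreal (LINT z:ball y r|\<nu>. \<bar>f z - s n z\<bar>)"
          unfolding set_lebesgue_integral_def
          by (rule nn_integral_eq_integral) (use set_integrable_ball[OF int] in \<open>auto simp: set_integrable_def\<close>)
        finally have "ennreal (LINT z:ball y r|\<nu>. \<bar>f z - s n z\<bar>) \<le> ennreal (e * measure \<nu> (ball y r))"
          using E(3)[OF that] e by (simp add: emeasure_eq_measure ennreal_mult)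
        then show "(LINT z:ball y r|\<nu>. \<bar>f z - s n z\<bar>) \<le> e * measure \<nu> (ball y r)"
          using e by (subst (asm) ennreal_le_iff) auto
      qed (use e in simp)
      ultimately show "\<exists>E. E \<in> sets \<nu> \<and> measure \<nu> E \<le> real C * I n / e \<and>
        (\<forall>y r. y \<notin> E \<longrightarrow> 0 < r \<longrightarrow> ball_avg \<nu> (\<lambda>z. \<bar>f z - s n z\<bar>) r y \<le> e)"
        using E(1) by blast
    qed
    from choice[OF this] obtain E where E: "\<And>n. E n \<in> sets \<nu>" "\<And>n. measure \<nu> (E n) \<le> real C * I n / e"
      "\<And>n y r. y \<notin> E n \<Longrightarrow> 0 < r \<Longrightarrow> ball_avg \<nu> (\<lambda>z. \<bar>f z - s n z\<bar>) r y \<le> e"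
      by blast
    define D where "D n = {z \<in> space \<nu>. e \<le> \<bar>f z - s n z\<bar>}" for n
    have D_sets: "D n \<in> sets \<nu>" for n unfolding D_def by measurable
    have D: "measure \<nu> (D n) \<le> I n / e" for n
      unfolding D_def I_def
      by (rule integral_Markov_inequality_measure[OF int, of "{}"]) (use e in auto)
    \<comment> \<open>An intersection suffices because a point needs only one good \<open>n\<close>;
      the measure of \<open>Z\<close> lies below every bound of a null sequence.\<close>
    define Z where "Z = (\<Inter>n. E n \<union> D n)"
    have Z_sets: "Z \<in> sets \<nu>" unfolding Z_def using E(1) D_sets by auto
    have "measure \<nu> Z \<le> (real C + 1) * I n / e" for n
    proof -
      have "measure \<nu> Z \<le> measure \<nu> (E n \<union> D n)"
        using E(1) D_sets by (intro finite_measure_mono) (auto simp: Z_def)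
      also have "\<dots> \<le> measure \<nu> (E n) + measure \<nu> (D n)"
        using E(1) D_sets by (intro measure_Un_le) auto
      also have "\<dots> \<le> (real C + 1) * I n / e"
        using E(2)[of n] D[of n] by (simp add: algebra_simps add_divide_distrib)
      finally show ?thesis .
    qed
    moreover have "(\<lambda>n. (real C + 1) * I n / e) \<longlonglongrightarrow> (real C + 1) * 0 / e"
      using L1 e unfolding I_def by (intro tendsto_intros) auto
    ultimately have "measure \<nu> Z \<le> 0" using LIMSEQ_le_const by fastforce
    then have "Z \<in> null_sets \<nu>" using Z_sets by (simp add: null_sets_def emeasure_eq_measure measure_le_0_iff)
    then have "AE y in \<nu>. y \<notin> Z" by (rule AE_not_in)
    moreover have "AE y in \<nu>. \<forall>n. ((\<lambda>r. ball_avg \<nu> (s n) r y) \<longlongrightarrow> s n y) (at_right 0)"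
      using diff by (simp add: AE_all_countable)
    ultimately show ?thesis
    proof eventually_elim
      case (elim y)
      then obtain n where n: "y \<notin> E n" "y \<notin> D n" by (auto simp: Z_def)
      have "\<forall>\<^sub>F r in at_right 0. dist (ball_avg \<nu> (s n) r y) (s n y) < e"
        using elim(2) e by (blast dest: tendstoD)
      moreover have "\<forall>\<^sub>F r in at_right (0::real). 0 < r" by (rule eventually_at_right_less)
      ultimately show ?case
      proof eventually_elim
        case (elim r)
        then show ?case
          using E(3)[OF n(1), of r] ball_avg_diff_le[OF f s, of r y n] n(2) by (simp add: dist_real_def D_def)
      qed
    qed
  qed
  \<comment> \<open>Restricting to countably many tolerances makes one null set serve them
    all.\<close>
  have "AE y in \<nu>. \<forall>k. \<forall>\<^sub>F r in at_right 0. dist (ball_avg \<nu> f r y) (f y) < 3 * inverse (real (Suc k))"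
    unfolding AE_all_countable by (intro allI AE_close) simp
  then show ?thesis
  proof eventually_elim
    case (elim y)
    show ?case
    proof (rule tendstoI)
      fix e :: real assume "0 < e"
      then obtain k where "inverse (real (Suc k)) < e / 3" using reals_Archimedean[of "e / 3"] by auto
      with elim[rule_format, of k] show "\<forall>\<^sub>F r in at_right 0. dist (ball_avg \<nu> f r y) (f y) < e"
        by (auto elim!: eventually_mono)
    qed
  qed
qed

text \<open>Regularity squeezes \<open>A\<close> between a compact \<open>K\<close> and an open
  \<open>U\<close>. A Urysohn function for \<open>K\<close> and \<open>- U\<close> can differ from
  the indicator only on \<open>U - K\<close>; the factor 2 collects one error from each
  side.\<close>

lemma differentiation_indicator:
  assumes A: "A \<in> sets borel"
  shows "AE y in \<nu>. ((\<lambda>r. ball_avg \<nu> (indicator A) r y) \<longlongrightarrow> indicator A y) (at_right 0)"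
proof -
  have "\<forall>n. \<exists>g. continuous_on UNIV g \<and> integrable \<nu> g \<and>
      (\<integral>z. \<bar>indicator A z - g z\<bar> \<partial>\<nu>) \<le> 2 * inverse (real (Suc n))"
  proof
    fix n
    let ?e = "inverse (real (Suc n))"
    have fin: "emeasure \<nu> (space \<nu>) \<noteq> \<infinity>" by simp
    obtain K where K: "K \<subseteq> A" "compact K" "measure \<nu> A < measure \<nu> K + ?e"
    proof -
      have "{K. K \<subseteq> A \<and> compact K} \<noteq> {}" by (auto intro: exI[of _ "{}"])
      then have "\<exists>K\<in>{K. K \<subseteq> A \<and> compact K}. emeasure \<nu> A < emeasure \<nu> K + ennreal ?e"
        by (intro SUP_approx_ennreal inner_regular[OF sets_eq fin A]) auto
      then show thesis
        using that by (auto simp: emeasure_eq_measure ennreal_less_iff simp flip: ennreal_plus)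
    qed
    obtain U where U: "A \<subseteq> U" "open U" "measure \<nu> U < measure \<nu> A + ?e"
    proof -
      have "emeasure \<nu> A < ennreal (measure \<nu> A + ?e)"
        by (simp add: emeasure_eq_measure ennreal_less_iff)
      then obtain U where "A \<subseteq> U" "open U" "emeasure \<nu> U < ennreal (measure \<nu> A + ?e)"
        unfolding outer_regular[OF sets_eq fin A] INF_less_iff by auto
      then show thesis
        using that by (auto simp: emeasure_eq_measure ennreal_less_iff simp flip: ennreal_plus)
    qed
    obtain g :: "'a \<Rightarrow> real" where g: "continuous_on UNIV g" "\<And>x. g x \<in> closed_segment 1 0"
      "\<And>x. x \<in> K \<Longrightarrow> g x = 1" "\<And>x. x \<in> - U \<Longrightarrow> g x = 0"
      using Urysohn[of K "- U" "1::real" 0] K(1,2) U(1,2) compact_imp_closed by blast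
    have g01: "0 \<le> g x \<and> g x \<le> 1" for x using g(2)[of x] by (simp add: closed_segment_eq_real_ivl)
    have [measurable]: "g \<in> borel_measurable borel" using g(1) by (rule borel_measurable_continuous_onI)
    have [measurable]: "A \<in> sets borel" "K \<in> sets borel" "U \<in> sets borel"
      using A K(2) U(2) by (auto intro: borel_compact)
    have int: "integrable \<nu> g" by (rule integrable_const_bound[of _ 1]) (use g01 in auto)
    have "(\<integral>z. \<bar>indicator A z - g z\<bar> \<partial>\<nu>) \<le> (\<integral>z. indicator (U - K) z \<partial>\<nu>)"
    proof (rule integral_mono)
      show "integrable \<nu> (\<lambda>z. \<bar>indicator A z - g z\<bar>)" using int by (auto simp: sets_eq emeasure_eq_measure)
      show "integrable \<nu> (indicator (U - K) :: 'a \<Rightarrow> real)" by (simp add: sets_eq emeasure_eq_measure)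
      show "\<bar>indicator A z - g z\<bar> \<le> indicator (U - K) z" for z
        using g(3,4)[of z] g01[of z] K(1) U(1) by (auto simp: indicator_def)
    qed
    also have "\<dots> = measure \<nu> U - measure \<nu> K"
      using K(1) U(1) by (simp add: sets_eq finite_measure_Diff)
    also have "\<dots> \<le> 2 * ?e" using K(3) U(3) by simp
    finally show "\<exists>g. continuous_on UNIV g \<and> integrable \<nu> g \<and>
      (\<integral>z. \<bar>indicator A z - g z\<bar> \<partial>\<nu>) \<le> 2 * inverse (real (Suc n))"
      using g(1) int by blast
  qed
  from choice[OF this] obtain g where g: "\<And>n. continuous_on UNIV (g n)" "\<And>n. integrable \<nu> (g n)"
    "\<And>n. (\<integral>z. \<bar>indicator A z - g n z\<bar> \<partial>\<nu>) \<le> 2 * inverse (real (Suc n))"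
    by blast
  show ?thesis
  proof (rule differentiation_L1_limit[where s = g])
    show "integrable \<nu> (indicator A :: 'a \<Rightarrow> real)" using A by (simp add: sets_eq emeasure_eq_measure)
    show "AE y in \<nu>. ((\<lambda>r. ball_avg \<nu> (g n) r y) \<longlongrightarrow> g n y) (at_right 0)" for n
      using AE_in_measure_support[OF sets_eq] by eventually_elim (rule ball_avg_tendsto_continuous[OF g(1,2)])
    have "(\<lambda>n. 2 * inverse (real (Suc n))) \<longlonglongrightarrow> 2 * 0" by (intro tendsto_mult tendsto_const LIMSEQ_inverse_real_of_nat)
    then have lim0: "(\<lambda>n. 2 * inverse (real (Suc n))) \<longlonglongrightarrow> 0" by simp
    show "(\<lambda>n. \<integral>z. \<bar>indicator A z - g n z\<bar> \<partial>\<nu>) \<longlonglongrightarrow> 0"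
    proof (rule Lim_null_comparison[OF _ lim0], intro always_eventually allI)
      show "norm (\<integral>z. \<bar>indicator A z - g n z\<bar> \<partial>\<nu>) \<le> 2 * inverse (real (Suc n))" for n
        using g(3)[of n] by (subst real_norm_def, subst abs_of_nonneg) auto
    qed
  qed (rule g(2))
qed

theorem lebesgue_differentiation:
  assumes "integrable \<nu> f"
  shows "AE y in \<nu>. ((\<lambda>r. ball_avg \<nu> f r y) \<longlongrightarrow> f y) (at_right 0)"
  using assms
proof (induction rule: integrable_induct)
  case (base A c)
  have "AE y in \<nu>. ((\<lambda>r. ball_avg \<nu> (indicator A) r y) \<longlongrightarrow> indicator A y) (at_right 0)"
    using base by (intro differentiation_indicator) (simp add: sets_eq)
  then show ?case
  proof eventually_elim
    case (elim y)
    have "ball_avg \<nu> (\<lambda>z. indicator A z *\<^sub>R c) r y = ball_avg \<nu> (indicator A) r y * c" for r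
      by (simp add: ball_avg_def)
    then show ?case using tendsto_mult_right[OF elim, of c] by simp
  qed
next
  case (add f g)
  from add(3,4) show ?case
    by eventually_elim (simp add: ball_avg_add[OF add(1,2)] tendsto_add)
next
  case (lim f s)
  show ?case
  proof (rule differentiation_L1_limit[OF lim(4,1,5)])
    have "(\<lambda>n. \<integral>z. \<bar>f z - s n z\<bar> \<partial>\<nu>) \<longlonglongrightarrow> (\<integral>z. 0 \<partial>\<nu>)"
    \<comment> \<open>The induction rule supplies
      \<open>\<bar>s n z\<bar> \<le> 2 * \<bar>f z\<bar>\<close>, whence the factor 3.\<close>
    proof (rule integral_dominated_convergence[where w = "\<lambda>z. 3 * \<bar>f z\<bar>"])
      show "AE z in \<nu>. (\<lambda>n. \<bar>f z - s n z\<bar>) \<longlonglongrightarrow> 0"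
      proof (rule AE_I2)
        fix z assume "z \<in> space \<nu>"
        from tendsto_rabs[OF tendsto_diff[OF tendsto_const lim(2)[OF this], of "f z"]]
        show "(\<lambda>n. \<bar>f z - s n z\<bar>) \<longlonglongrightarrow> 0" by simp
      qed
      show "AE z in \<nu>. norm \<bar>f z - s n z\<bar> \<le> 3 * \<bar>f z\<bar>" for n
        by (rule AE_I2) (use lim(3)[of _ n] in fastforce)
    qed (use lim(1,4) in auto)
    then show "(\<lambda>n. \<integral>z. \<bar>f z - s n z\<bar> \<partial>\<nu>) \<longlonglongrightarrow> 0" by simp
  qed
qed

end

section \<open>Prediction error and conditional expectation\<close>

lemma norm_sq_eq_sum_Basis: "(norm v)\<^sup>2 = (\<Sum>b\<in>Basis. (v \<bullet> b)\<^sup>2)"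
  for v :: "'a::euclidean_space"
  unfolding power2_norm_eq_inner by (subst euclidean_inner) (simp add: power2_eq_square)

text \<open>Isolates what the measure-theoretic argument uses of the dynamics; boundedness,
  invariance and compactness act later by establishing \<open>next_L2\<close>.\<close>

locale prediction = prob_space \<mu> for \<mu> :: "'a measure" +
  fixes T :: "'a \<Rightarrow> 'a" and \<phi> :: "'a \<Rightarrow> 'b::euclidean_space"
  assumes phi_meas [measurable]: "\<phi> \<in> borel_measurable \<mu>"
    and next_L2: "in_L2 \<mu> (\<lambda>x. \<phi> (T x))"
begin

abbreviation (input) "\<nu> \<equiv> distr \<mu> borel \<phi>"

sublocale push: finite_borel_measure \<nu>
proof -
  interpret d: prob_space \<nu> by (rule prob_space_distr) measurable
  show "finite_borel_measure \<nu>" by unfold_locales simp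
qed

lemma next_meas [measurable]: "(\<lambda>x. \<phi> (T x)) \<in> borel_measurable \<mu>"
  using next_L2 by (simp add: in_L2_def)

lemma next_sq_integrable: "integrable \<mu> (\<lambda>x. (norm (\<phi> (T x)))\<^sup>2)"
  using next_L2 by (simp add: in_L2_def)

text \<open>Constants are integrable for a probability measure, and
  \<open>t \<le> 1 + t\<^sup>2\<close>.\<close>

lemma next_integrable: "integrable \<mu> (\<lambda>x. \<phi> (T x))"
proof (rule Bochner_Integration.integrable_bound)
  show "integrable \<mu> (\<lambda>x. 1 + (norm (\<phi> (T x)))\<^sup>2)" using next_sq_integrable by simp
  show "AE x in \<mu>. norm (\<phi> (T x)) \<le> norm (1 + (norm (\<phi> (T x)))\<^sup>2)"
  proof (rule AE_I2)
    fix x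
    have "0 \<le> (norm (\<phi> (T x)) - 1)\<^sup>2 + (norm (\<phi> (T x)))\<^sup>2" by simp
    then show "norm (\<phi> (T x)) \<le> norm (1 + (norm (\<phi> (T x)))\<^sup>2)"
      by (simp add: power2_eq_square algebra_simps)
  qed
qed measurable

lemma phi_ball_sets [measurable]: "phi_ball \<mu> \<phi> \<epsilon> y \<in> sets \<mu>"
  unfolding phi_ball_def by measurable

lemma measure_phi_ball: "measure \<mu> (phi_ball \<mu> \<phi> \<epsilon> y) = measure \<nu> (ball y \<epsilon>)"
  by (simp add: phi_ball_def measure_distr)

lemma set_integrable_phi_ball:
  "integrable \<mu> f \<Longrightarrow> set_integrable \<mu> (phi_ball \<mu> \<phi> \<epsilon> y) f"
  for f :: "'a \<Rightarrow> 'c::{banach, second_countable_topology}"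
  unfolding set_integrable_def by (rule integrable_mult_indicator) auto

lemma set_integral_phi_ball:
  fixes f :: "'b \<Rightarrow> 'c::{banach, second_countable_topology}"
  assumes [measurable]: "f \<in> borel_measurable borel"
  shows "(LINT x:phi_ball \<mu> \<phi> \<epsilon> y|\<mu>. f (\<phi> x)) = (LINT z:ball y \<epsilon>|\<nu>. f z)"
proof -
  have [measurable]: "ball y \<epsilon> \<in> sets borel" by simp
  have "(LINT z:ball y \<epsilon>|\<nu>. f z) = (\<integral>x. indicator (ball y \<epsilon>) (\<phi> x) *\<^sub>R f (\<phi> x) \<partial>\<mu>)"
    unfolding set_lebesgue_integral_def by (rule integral_distr) measurable
  also have "\<dots> = (LINT x:phi_ball \<mu> \<phi> \<epsilon> y|\<mu>. f (\<phi> x))"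
    unfolding set_lebesgue_integral_def
    by (rule Bochner_Integration.integral_cong) (auto simp: phi_ball_def indicator_def)
  finally show ?thesis by simp
qed

lemma pred_error_exists:
  assumes "y \<in> measure_support \<nu>" "0 < \<epsilon>"
  shows "pred_error_exists \<mu> T \<phi> \<epsilon> y"
  unfolding pred_error_exists_def
proof (intro conjI set_integrable_phi_ball next_integrable)
  show "0 < measure \<mu> (phi_ball \<mu> \<phi> \<epsilon> y)"
    unfolding measure_phi_ball by (rule push.measure_ball_pos[OF assms])
  have "(norm (\<phi> (T x) - c))\<^sup>2 = (norm (\<phi> (T x)))\<^sup>2 - 2 * (\<phi> (T x) \<bullet> c) + (norm c)\<^sup>2" for x c
    by (simp add: power2_norm_eq_inner inner_diff inner_commute)
  then show "integrable \<mu> (\<lambda>x. (norm (\<phi> (T x) - \<chi>\<^sub>p \<mu> T \<phi> \<epsilon> y))\<^sup>2)"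
    using next_sq_integrable next_integrable by simp
qed

lemma pred_error_sq:
  assumes "y \<in> measure_support \<nu>" "0 < \<epsilon>"
  shows "(\<sigma>\<^sub>p \<mu> T \<phi> \<epsilon> y)\<^sup>2 =
    (LINT x:phi_ball \<mu> \<phi> \<epsilon> y|\<mu>. (norm (\<phi> (T x)))\<^sup>2) / measure \<nu> (ball y \<epsilon>) - (norm (\<chi>\<^sub>p \<mu> T \<phi> \<epsilon> y))\<^sup>2"
proof -
  define m where "m = measure \<nu> (ball y \<epsilon>)"
  define c where "c = \<chi>\<^sub>p \<mu> T \<phi> \<epsilon> y"
  let ?B = "phi_ball \<mu> \<phi> \<epsilon> y"
  have m: "0 < m" unfolding m_def by (rule push.measure_ball_pos[OF assms])
  note int = set_integrable_phi_ball[of _ \<epsilon> y]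
  have expand: "(norm (\<phi> (T x) - c))\<^sup>2 = (norm (\<phi> (T x)))\<^sup>2 - 2 * (\<phi> (T x) \<bullet> c) + (norm c)\<^sup>2" for x
    by (simp add: power2_norm_eq_inner inner_diff inner_commute)
  have mean: "(LINT x:?B|\<mu>. \<phi> (T x) \<bullet> c) = m * (norm c)\<^sup>2"
  proof -
    have "(LINT x:?B|\<mu>. \<phi> (T x) \<bullet> c) = (LINT x:?B|\<mu>. \<phi> (T x)) \<bullet> c"
      using integral_inner_left[of c \<mu> "\<lambda>x. indicator ?B x *\<^sub>R \<phi> (T x)"] int[OF next_integrable]
      by (simp add: set_lebesgue_integral_def set_integrable_def)
    \<comment> \<open>By definition \<open>c\<close> is the mean over the ball, so the cross term
      becomes twice \<open>m * (norm c)\<^sup>2\<close> and outweighs the constant term by one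
      copy.\<close>
    also have "(LINT x:?B|\<mu>. \<phi> (T x)) = m *\<^sub>R c"
      using m by (simp add: c_def pred_mean_def measure_phi_ball m_def)
    finally show ?thesis by (simp add: power2_norm_eq_inner)
  qed
  have "(LINT x:?B|\<mu>. (norm (\<phi> (T x) - c))\<^sup>2) =
      (LINT x:?B|\<mu>. (norm (\<phi> (T x)))\<^sup>2) - 2 * (LINT x:?B|\<mu>. \<phi> (T x) \<bullet> c) + (LINT x:?B|\<mu>. (norm c)\<^sup>2)"
  proof -
    have "integrable \<mu> (\<lambda>x. 2 * (\<phi> (T x) \<bullet> c))" using next_integrable by simp
    note i = int[OF next_sq_integrable] int[OF this] int[OF integrable_const[of "(norm c)\<^sup>2"]]
    show ?thesis
      unfolding expand
      by (subst set_integral_add(2), intro set_integral_diff(1) i, rule i(3), subst set_integral_diff(2), rule i(1), rule i(2)) simp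
  qed
  also have "(LINT x:?B|\<mu>. (norm c)\<^sup>2) = m * (norm c)\<^sup>2"
    by (simp add: set_integral_const emeasure_eq_measure measure_phi_ball m_def)
  finally have eq: "(LINT x:?B|\<mu>. (norm (\<phi> (T x) - c))\<^sup>2) = (LINT x:?B|\<mu>. (norm (\<phi> (T x)))\<^sup>2) - m * (norm c)\<^sup>2"
    unfolding mean by simp
  \<comment> \<open>Nonnegativity of the radicand is needed for the square to cancel the root in
    \<open>\<sigma>\<^sub>p\<close>.\<close>
  have "0 \<le> (LINT x:?B|\<mu>. (norm (\<phi> (T x) - c))\<^sup>2)"
    unfolding set_lebesgue_integral_def by (rule Bochner_Integration.integral_nonneg) auto
  then have "(\<sigma>\<^sub>p \<mu> T \<phi> \<epsilon> y)\<^sup>2 = (LINT x:?B|\<mu>. (norm (\<phi> (T x) - c))\<^sup>2) / m"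
    using m by (simp add: pred_error_def measure_phi_ball flip: c_def m_def)
  then show ?thesis using m unfolding eq by (simp add: c_def m_def diff_divide_distrib)
qed

text \<open>
  The variance decomposition of \<open>\<sigma>\<^sub>p\<close> turns the limit into one about plain ball averages; \<open>G\<close> and
  \<open>H\<close> play the roles of the conditional expectations of \<open>\<phi> \<circ> T\<close> and of its squared norm given \<open>\<phi>\<close>.
\<close>
lemma pred_error_sq_tendsto:
  assumes G: "\<And>b. b \<in> Basis \<Longrightarrow> integrable \<nu> (G b)"
      "\<And>b y \<epsilon>. b \<in> Basis \<Longrightarrow> (LINT x:phi_ball \<mu> \<phi> \<epsilon> y|\<mu>. \<phi> (T x) \<bullet> b) = (LINT z:ball y \<epsilon>|\<nu>. G b z)"
    and H: "integrable \<nu> H"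
      "\<And>y \<epsilon>. (LINT x:phi_ball \<mu> \<phi> \<epsilon> y|\<mu>. (norm (\<phi> (T x)))\<^sup>2) = (LINT z:ball y \<epsilon>|\<nu>. H z)"
  shows "AE y in \<nu>. ((\<lambda>\<epsilon>. (\<sigma>\<^sub>p \<mu> T \<phi> \<epsilon> y)\<^sup>2) \<longlongrightarrow> H y - (\<Sum>b\<in>Basis. (G b y)\<^sup>2)) (at_right 0)"
proof -
  \<comment> \<open>Differentiation is available for real functions, so the vector-valued mean is
    handled through its finitely many coordinates.\<close>
  have "AE y in \<nu>. \<forall>b\<in>Basis. ((\<lambda>\<epsilon>. ball_avg \<nu> (G b) \<epsilon> y) \<longlongrightarrow> G b y) (at_right 0)"
    by (rule AE_finite_allI) (auto intro: push.lebesgue_differentiation G(1))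
  moreover have "AE y in \<nu>. ((\<lambda>\<epsilon>. ball_avg \<nu> H \<epsilon> y) \<longlongrightarrow> H y) (at_right 0)"
    by (rule push.lebesgue_differentiation[OF H(1)])
  moreover have "AE y in \<nu>. y \<in> measure_support \<nu>"
    by (rule AE_in_measure_support) simp
  ultimately show ?thesis
  proof eventually_elim
    case (elim y)
    have eq: "(\<sigma>\<^sub>p \<mu> T \<phi> \<epsilon> y)\<^sup>2 = ball_avg \<nu> H \<epsilon> y - (\<Sum>b\<in>Basis. (ball_avg \<nu> (G b) \<epsilon> y)\<^sup>2)"
      if "0 < \<epsilon>" for \<epsilon>
    proof -
      have "\<chi>\<^sub>p \<mu> T \<phi> \<epsilon> y \<bullet> b = ball_avg \<nu> (G b) \<epsilon> y" if "b \<in> Basis" for b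
        using integral_inner_left[of b \<mu> "\<lambda>x. indicator (phi_ball \<mu> \<phi> \<epsilon> y) x *\<^sub>R \<phi> (T x)"]
          set_integrable_phi_ball[OF next_integrable, of \<epsilon> y] G(2)[OF that, of \<epsilon> y]
        by (simp add: pred_mean_def ball_avg_def measure_phi_ball set_lebesgue_integral_def set_integrable_def)
      then have "(norm (\<chi>\<^sub>p \<mu> T \<phi> \<epsilon> y))\<^sup>2 = (\<Sum>b\<in>Basis. (ball_avg \<nu> (G b) \<epsilon> y)\<^sup>2)"
        by (simp add: norm_sq_eq_sum_Basis)
      then show ?thesis
        using pred_error_sq[OF elim(3) that] H(2)[of \<epsilon> y] by (simp add: ball_avg_def)
    qed
    have "((\<lambda>\<epsilon>. ball_avg \<nu> H \<epsilon> y - (\<Sum>b\<in>Basis. (ball_avg \<nu> (G b) \<epsilon> y)\<^sup>2)) \<longlongrightarrow>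
        H y - (\<Sum>b\<in>Basis. (G b y)\<^sup>2)) (at_right 0)"
      using elim(1,2) by (intro tendsto_intros) auto
    moreover have "\<forall>\<^sub>F \<epsilon> in at_right 0. ball_avg \<nu> H \<epsilon> y - (\<Sum>b\<in>Basis. (ball_avg \<nu> (G b) \<epsilon> y)\<^sup>2) = (\<sigma>\<^sub>p \<mu> T \<phi> \<epsilon> y)\<^sup>2"
      using eventually_at_right_less[of "0::real"] by eventually_elim (simp add: eq)
    ultimately show ?case by (rule Lim_transform_eventually)
  qed
qed

section \<open>Conditional expectation given \<open>\<phi>\<close>, as a function on the target
  space\<close>

text \<open>\<open>G\<close> is the Radon-Nikodym derivative of the push-forward of \<open>F\<close>
  times \<open>\<mu>\<close>, so \<open>G \<circ> \<phi>\<close> is a version of the conditional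
  expectation. Equivalence of integrability admits unbounded \<open>g\<close> and prevents the
  integral identity from comparing default values only.\<close>

lemma conditional_expectation_nonneg:
  fixes F :: "'a \<Rightarrow> real"
  assumes F: "integrable \<mu> F" "\<And>x. 0 \<le> F x"
  shows "\<exists>G. integrable \<nu> G \<and> (\<forall>g\<in>borel_measurable borel.
    (integrable \<nu> (\<lambda>z. g z * G z) \<longleftrightarrow> integrable \<mu> (\<lambda>x. g (\<phi> x) * F x)) \<and>
    (\<integral>z. g z * G z \<partial>\<nu>) = (\<integral>x. g (\<phi> x) * F x \<partial>\<mu>))"
proof -
  note [measurable] = borel_measurable_integrable[OF F(1)]
  define D where "D = density \<mu> F"
  define N where "N = distr D borel \<phi>"
  have meas_D [measurable_cong]: "sets D = sets \<mu>" by (simp add: D_def)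
  have "emeasure D (space D) = ennreal (\<integral>x. F x \<partial>\<mu>)"
    using nn_integral_eq_integral[OF F(1)] F(2)
    by (simp add: D_def emeasure_density cong: nn_integral_cong)
  then interpret D: finite_measure D by (intro finite_measureI) simp
  have N_meas: "\<phi> \<in> measurable D borel" by measurable
  interpret N: finite_measure N unfolding N_def by (rule D.finite_measure_distr[OF N_meas])
  have ac: "absolutely_continuous \<nu> N"
    unfolding absolutely_continuous_def
  proof
    fix A assume "A \<in> null_sets \<nu>"
    then have A: "A \<in> sets borel" "\<phi> -` A \<inter> space \<mu> \<in> null_sets \<mu>"
      by (auto simp: null_sets_def emeasure_distr)
    have "absolutely_continuous \<mu> D" unfolding D_def by (rule absolutely_continuousI_density) measurable
    then have "\<phi> -` A \<inter> space \<mu> \<in> null_sets D" using A(2) by (auto simp: absolutely_continuous_def)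
    then show "A \<in> null_sets N"
      using A(1) N_meas by (auto simp: null_sets_def N_def emeasure_distr D_def)
  qed
  have sets_N: "sets N = sets \<nu>" by (simp add: N_def)
  obtain G where G: "G \<in> borel_measurable \<nu>" "AE z in \<nu>. RN_deriv \<nu> N z = ennreal (G z)" "\<And>z. 0 \<le> G z"
    using push.real_RN_deriv[OF N.finite_measure_axioms ac sets_N] by blast
  have [measurable]: "G \<in> borel_measurable borel" using G(1) by simp
  have "density \<nu> (RN_deriv \<nu> N) = density \<nu> (\<lambda>z. ennreal (G z))"
    using G(1,2) by (intro density_cong) auto
  then have N_eq: "density \<nu> (\<lambda>z. ennreal (G z)) = N"
    using push.density_RN_deriv[OF ac sets_N] by simp
  have transfer: "(integrable \<nu> (\<lambda>z. g z * G z) \<longleftrightarrow> integrable \<mu> (\<lambda>x. g (\<phi> x) * F x)) \<and>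
    (\<integral>z. g z * G z \<partial>\<nu>) = (\<integral>x. g (\<phi> x) * F x \<partial>\<mu>)"
    if [measurable]: "g \<in> borel_measurable borel" for g :: "'b \<Rightarrow> real"
  proof
    have "integrable \<nu> (\<lambda>z. g z * G z) \<longleftrightarrow> integrable N g"
      unfolding N_eq[symmetric] using G(3) by (subst integrable_density) (auto simp: mult.commute)
    also have "\<dots> \<longleftrightarrow> integrable D (\<lambda>x. g (\<phi> x))"
      unfolding N_def by (rule integrable_distr_eq) measurable
    also have "\<dots> \<longleftrightarrow> integrable \<mu> (\<lambda>x. g (\<phi> x) * F x)"
      unfolding D_def using F(2) by (subst integrable_density) (auto simp: mult.commute)
    finally show "integrable \<nu> (\<lambda>z. g z * G z) \<longleftrightarrow> integrable \<mu> (\<lambda>x. g (\<phi> x) * F x)" .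
    have "(\<integral>z. g z * G z \<partial>\<nu>) = (\<integral>z. g z \<partial>N)"
      unfolding N_eq[symmetric] using G(3) by (subst integral_density) (auto simp: mult.commute)
    also have "\<dots> = (\<integral>x. g (\<phi> x) \<partial>D)"
      unfolding N_def by (rule integral_distr) measurable
    also have "\<dots> = (\<integral>x. g (\<phi> x) * F x \<partial>\<mu>)"
      unfolding D_def using F(2) by (subst integral_density) (auto simp: mult.commute)
    finally show "(\<integral>z. g z * G z \<partial>\<nu>) = (\<integral>x. g (\<phi> x) * F x \<partial>\<mu>)" .
  qed
  moreover have "integrable \<nu> G" using transfer[of "\<lambda>_. 1"] F(1) by simp
  ultimately show ?thesis by blast
qed

text \<open>Positive and negative parts are treated separately; integrability of
  \<open>g (\<phi> x) * F x\<close> passes to both, each being dominated by it in absolute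
  value.\<close>

lemma conditional_expectation:
  fixes F :: "'a \<Rightarrow> real"
  assumes F: "integrable \<mu> F"
  shows "\<exists>G. integrable \<nu> G \<and>
    (\<forall>g\<in>borel_measurable borel. integrable \<mu> (\<lambda>x. g (\<phi> x) * F x) \<longrightarrow>
      (\<integral>z. g z * G z \<partial>\<nu>) = (\<integral>x. g (\<phi> x) * F x \<partial>\<mu>))"
proof -
  note [measurable] = borel_measurable_integrable[OF F]
  have int: "integrable \<mu> (\<lambda>x. max 0 (F x))" "integrable \<mu> (\<lambda>x. max 0 (- F x))" using F by auto
  obtain G1 where G1: "integrable \<nu> G1" "\<forall>g\<in>borel_measurable borel.
    (integrable \<nu> (\<lambda>z. g z * G1 z) \<longleftrightarrow> integrable \<mu> (\<lambda>x. g (\<phi> x) * max 0 (F x))) \<and>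
    (\<integral>z. g z * G1 z \<partial>\<nu>) = (\<integral>x. g (\<phi> x) * max 0 (F x) \<partial>\<mu>)"
    using conditional_expectation_nonneg[OF int(1)] by auto
  obtain G2 where G2: "integrable \<nu> G2" "\<forall>g\<in>borel_measurable borel.
    (integrable \<nu> (\<lambda>z. g z * G2 z) \<longleftrightarrow> integrable \<mu> (\<lambda>x. g (\<phi> x) * max 0 (- F x))) \<and>
    (\<integral>z. g z * G2 z \<partial>\<nu>) = (\<integral>x. g (\<phi> x) * max 0 (- F x) \<partial>\<mu>)"
    using conditional_expectation_nonneg[OF int(2)] by auto
  show ?thesis
  proof (intro exI[of _ "\<lambda>z. G1 z - G2 z"] conjI ballI impI)
    show "integrable \<nu> (\<lambda>z. G1 z - G2 z)" using G1(1) G2(1) by simp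
    fix g :: "'b \<Rightarrow> real" assume g [measurable]: "g \<in> borel_measurable borel"
      and gF: "integrable \<mu> (\<lambda>x. g (\<phi> x) * F x)"
    have i1: "integrable \<mu> (\<lambda>x. g (\<phi> x) * max 0 (F x))"
      by (rule Bochner_Integration.integrable_bound[OF gF]) (auto simp: abs_mult intro!: mult_left_mono)
    have i2: "integrable \<mu> (\<lambda>x. g (\<phi> x) * max 0 (- F x))"
      by (rule Bochner_Integration.integrable_bound[OF gF]) (auto simp: abs_mult intro!: mult_left_mono)
    have "(\<integral>z. g z * (G1 z - G2 z) \<partial>\<nu>) = (\<integral>z. g z * G1 z \<partial>\<nu>) - (\<integral>z. g z * G2 z \<partial>\<nu>)"
      unfolding right_diff_distrib using G1(2) G2(2) g i1 i2 by (intro Bochner_Integration.integral_diff) auto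
    also have "\<dots> = (\<integral>x. g (\<phi> x) * max 0 (F x) \<partial>\<mu>) - (\<integral>x. g (\<phi> x) * max 0 (- F x) \<partial>\<mu>)"
      using G1(2) G2(2) g by simp
    also have "\<dots> = (\<integral>x. g (\<phi> x) * max 0 (F x) - g (\<phi> x) * max 0 (- F x) \<partial>\<mu>)"
      by (rule Bochner_Integration.integral_diff[OF i1 i2, symmetric])
    also have "\<dots> = (\<integral>x. g (\<phi> x) * F x \<partial>\<mu>)"
      by (rule Bochner_Integration.integral_cong) (auto simp: max_def)
    finally show "(\<integral>z. g z * (G1 z - G2 z) \<partial>\<nu>) = (\<integral>x. g (\<phi> x) * F x \<partial>\<mu>)" .
  qed
qed

section \<open>From a factorization through \<open>\<phi>\<close> to predictability\<close>

text \<open>The function \<open>f\<close> stands for a coordinate, the squared norm, or the squared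
  distance to the mean.\<close>

lemma set_integral_factor:
  fixes f :: "'b \<Rightarrow> 'c::{banach, second_countable_topology}"
  assumes [measurable]: "G \<in> borel_measurable borel" "f \<in> borel_measurable borel"
    and G: "AE x in \<mu>. \<phi> (T x) = G (\<phi> x)"
  shows "(LINT x:phi_ball \<mu> \<phi> \<epsilon> y|\<mu>. f (\<phi> (T x))) = (LINT z:ball y \<epsilon>|\<nu>. f (G z))"
proof -
  have "(LINT z:ball y \<epsilon>|\<nu>. f (G z)) = (LINT x:phi_ball \<mu> \<phi> \<epsilon> y|\<mu>. f (G (\<phi> x)))"
    by (rule set_integral_phi_ball[symmetric]) measurable
  also have "\<dots> = (LINT x:phi_ball \<mu> \<phi> \<epsilon> y|\<mu>. f (\<phi> (T x)))"
    unfolding set_lebesgue_integral_def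
    by (rule integral_cong_AE) (use G in \<open>auto elim!: eventually_mono\<close>)
  finally show ?thesis by simp
qed

lemma integrable_factor:
  fixes f :: "'b \<Rightarrow> 'c::{banach, second_countable_topology}"
  assumes [measurable]: "G \<in> borel_measurable borel" "f \<in> borel_measurable borel"
    and G: "AE x in \<mu>. \<phi> (T x) = G (\<phi> x)"
  shows "integrable \<nu> (\<lambda>z. f (G z)) \<longleftrightarrow> integrable \<mu> (\<lambda>x. f (\<phi> (T x)))"
proof -
  have "integrable \<nu> (\<lambda>z. f (G z)) \<longleftrightarrow> integrable \<mu> (\<lambda>x. f (G (\<phi> x)))"
    by (rule integrable_distr_eq) measurable
  also have "\<dots> \<longleftrightarrow> integrable \<mu> (\<lambda>x. f (\<phi> (T x)))"
    by (rule integrable_cong_AE) (use G in \<open>auto elim!: eventually_mono\<close>)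
  finally show ?thesis .
qed

text \<open>Under the factorization \<open>G\<close> and its squared norm are themselves the
  conditional expectations, and the limiting variance vanishes because the squared norm is the sum
  of the squared coordinates.\<close>

lemma pred_error_tendsto_0:
  assumes [measurable]: "G \<in> borel_measurable borel" and G: "AE x in \<mu>. \<phi> (T x) = G (\<phi> x)"
  shows "AE y in \<nu>. ((\<lambda>\<epsilon>. \<sigma>\<^sub>p \<mu> T \<phi> \<epsilon> y) \<longlongrightarrow> 0) (at_right 0)"
proof -
  have "AE y in \<nu>. ((\<lambda>\<epsilon>. (\<sigma>\<^sub>p \<mu> T \<phi> \<epsilon> y)\<^sup>2) \<longlongrightarrow> (norm (G y))\<^sup>2 - (\<Sum>b\<in>Basis. (G y \<bullet> b)\<^sup>2)) (at_right 0)"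
  proof (rule pred_error_sq_tendsto)
    show "integrable \<nu> (\<lambda>z. G z \<bullet> b)" for b
      using next_integrable integrable_factor[OF assms(1) _ G, of "\<lambda>v. v \<bullet> b"] by simp
    show "integrable \<nu> (\<lambda>z. (norm (G z))\<^sup>2)"
      using next_sq_integrable integrable_factor[OF assms(1) _ G, of "\<lambda>v. (norm v)\<^sup>2"] by simp
    show "(LINT x:phi_ball \<mu> \<phi> \<epsilon> y|\<mu>. \<phi> (T x) \<bullet> b) = (LINT z:ball y \<epsilon>|\<nu>. G z \<bullet> b)" for b y \<epsilon>
      using G by (intro set_integral_factor) measurable
    show "(LINT x:phi_ball \<mu> \<phi> \<epsilon> y|\<mu>. (norm (\<phi> (T x)))\<^sup>2) = (LINT z:ball y \<epsilon>|\<nu>. (norm (G z))\<^sup>2)" for y \<epsilon>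
      using G by (intro set_integral_factor) measurable
  qed
  then show ?thesis
  proof eventually_elim
    case (elim y)
    have "(norm (G y))\<^sup>2 - (\<Sum>b\<in>Basis. (G y \<bullet> b)\<^sup>2) = 0"
      by (simp add: norm_sq_eq_sum_Basis)
    with elim have "((\<lambda>\<epsilon>. (\<sigma>\<^sub>p \<mu> T \<phi> \<epsilon> y)\<^sup>2) \<longlongrightarrow> 0) (at_right 0)" by simp
    then have "((\<lambda>\<epsilon>. sqrt ((\<sigma>\<^sub>p \<mu> T \<phi> \<epsilon> y)\<^sup>2)) \<longlongrightarrow> sqrt 0) (at_right 0)" by (rule tendsto_real_sqrt)
    then show ?case by (simp add: tendsto_rabs_zero_iff)
  qed
qed

lemma as_predictableI:
  assumes "G \<in> borel_measurable borel" "AE x in \<mu>. \<phi> (T x) = G (\<phi> x)"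
  shows "as_predictable \<mu> T \<phi>"
proof -
  have "AE y in \<nu>. y \<in> measure_support \<nu>" by (rule AE_in_measure_support) simp
  with pred_error_tendsto_0[OF assms] have "AE y in \<nu>. predictable_point \<mu> T \<phi> y"
  proof eventually_elim
    case (elim y)
    have "\<forall>\<^sub>F \<epsilon> in at_right 0. pred_error_exists \<mu> T \<phi> \<epsilon> y"
      using eventually_at_right_less[of "0::real"] by eventually_elim (rule pred_error_exists[OF elim(2)])
    with elim show ?case by (simp add: predictable_point_def)
  qed
  then show ?thesis by (simp add: as_predictable_def)
qed

section \<open>From predictability to a factorization through \<open>\<phi>\<close>\<close>

text \<open>
  Predictability says that the conditional variance of \<open>\<phi> \<circ> T\<close> given \<open>\<phi>\<close> vanishes, hence \<open>\<phi> \<circ> T\<close>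
  coincides with its conditional expectation, which is a function of \<open>\<phi>\<close>.
\<close>
lemma as_predictable_imp_factor:
  assumes "as_predictable \<mu> T \<phi>"
  shows "\<exists>G\<in>borel_measurable borel. AE x in \<mu>. \<phi> (T x) = G (\<phi> x)"
proof -
  have Fb: "integrable \<mu> (\<lambda>x. \<phi> (T x) \<bullet> b)" for b using next_integrable by simp
  have "\<forall>b. \<exists>G. integrable \<nu> G \<and> (\<forall>g\<in>borel_measurable borel. integrable \<mu> (\<lambda>x. g (\<phi> x) * (\<phi> (T x) \<bullet> b)) \<longrightarrow>
      (\<integral>z. g z * G z \<partial>\<nu>) = (\<integral>x. g (\<phi> x) * (\<phi> (T x) \<bullet> b) \<partial>\<mu>))"
    by (intro allI conditional_expectation Fb)
  from choice[OF this] obtain G where G: "\<And>b. integrable \<nu> (G b)"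
    "\<And>b g. g \<in> borel_measurable borel \<Longrightarrow> integrable \<mu> (\<lambda>x. g (\<phi> x) * (\<phi> (T x) \<bullet> b)) \<Longrightarrow>
      (\<integral>z. g z * G b z \<partial>\<nu>) = (\<integral>x. g (\<phi> x) * (\<phi> (T x) \<bullet> b) \<partial>\<mu>)"
    by auto
  have [measurable]: "G b \<in> borel_measurable borel" for b
    using borel_measurable_integrable[OF G(1)[of b]] by simp
  obtain H where H: "integrable \<nu> H"
    "\<And>g. g \<in> borel_measurable borel \<Longrightarrow> integrable \<mu> (\<lambda>x. g (\<phi> x) * (norm (\<phi> (T x)))\<^sup>2) \<Longrightarrow>
      (\<integral>z. g z * H z \<partial>\<nu>) = (\<integral>x. g (\<phi> x) * (norm (\<phi> (T x)))\<^sup>2 \<partial>\<mu>)"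
    using conditional_expectation[OF next_sq_integrable] by auto
  \<comment> \<open>The ball identities are the defining property of \<open>E\<close> tested on
    indicators of balls.\<close>
  have set_eq: "(LINT x:phi_ball \<mu> \<phi> \<epsilon> y|\<mu>. F x) = (LINT z:ball y \<epsilon>|\<nu>. E z)"
    if F: "integrable \<mu> F" and E: "\<And>g. g \<in> borel_measurable borel \<Longrightarrow> integrable \<mu> (\<lambda>x. g (\<phi> x) * F x) \<Longrightarrow>
      (\<integral>z. g z * E z \<partial>\<nu>) = (\<integral>x. g (\<phi> x) * F x \<partial>\<mu>)" for E and F :: "'a \<Rightarrow> real" and \<epsilon> y
  proof -
    have ind: "indicator (phi_ball \<mu> \<phi> \<epsilon> y) x *\<^sub>R F x = indicator (ball y \<epsilon>) (\<phi> x) * F x" if "x \<in> space \<mu>" for x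
      using that by (auto simp: phi_ball_def indicator_def)
    have "integrable \<mu> (\<lambda>x. indicator (ball y \<epsilon>) (\<phi> x) * F x)"
      using set_integrable_phi_ball[OF F, of \<epsilon> y] unfolding set_integrable_def
      by (simp only: ind cong: Bochner_Integration.integrable_cong)
    then have "(\<integral>z. indicator (ball y \<epsilon>) z * E z \<partial>\<nu>) = (\<integral>x. indicator (ball y \<epsilon>) (\<phi> x) * F x \<partial>\<mu>)"
      by (intro E borel_measurable_indicator) auto
    also have "\<dots> = (\<integral>x. indicator (phi_ball \<mu> \<phi> \<epsilon> y) x *\<^sub>R F x \<partial>\<mu>)"
      by (rule Bochner_Integration.integral_cong[OF refl]) (simp only: ind)
    finally show ?thesis unfolding set_lebesgue_integral_def by simp
  qed
  have "AE y in \<nu>. ((\<lambda>\<epsilon>. (\<sigma>\<^sub>p \<mu> T \<phi> \<epsilon> y)\<^sup>2) \<longlongrightarrow> H y - (\<Sum>b\<in>Basis. (G b y)\<^sup>2)) (at_right 0)"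
    by (rule pred_error_sq_tendsto) (intro G(1) H(1) set_eq Fb next_sq_integrable G(2) H(2); assumption)+
  moreover have "AE y in \<nu>. predictable_point \<mu> T \<phi> y"
    using assms by (simp add: as_predictable_def)
  \<comment> \<open>Differentiation and predictability both give a limit of the squared error;
    uniqueness of limits identifies them.\<close>
  ultimately have H_eq: "AE y in \<nu>. H y = (\<Sum>b\<in>Basis. (G b y)\<^sup>2)"
  proof eventually_elim
    case (elim y)
    have "((\<lambda>\<epsilon>. (\<sigma>\<^sub>p \<mu> T \<phi> \<epsilon> y)\<^sup>2) \<longlongrightarrow> 0\<^sup>2) (at_right 0)"
      using elim(2) unfolding predictable_point_def by (intro tendsto_power) auto
    from tendsto_unique[OF _ elim(1) this] show ?case by simp
  qed
  have [measurable]: "H \<in> borel_measurable borel" using borel_measurable_integrable[OF H(1)] by simp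
  \<comment> \<open>The conditional means are so far only known to be integrable; their square
    integrability is read off from \<open>H\<close>, which dominates each square almost
    everywhere.\<close>
  have sum_int: "integrable \<nu> (\<lambda>y. \<Sum>b\<in>Basis. (G b y)\<^sup>2)"
    using H_eq H(1) by (subst integrable_cong_AE[of _ _ H]) (auto elim!: eventually_mono)
  have G2: "integrable \<nu> (\<lambda>y. (G b y)\<^sup>2)" if "b \<in> Basis" for b
  proof (rule Bochner_Integration.integrable_bound[OF sum_int])
    show "AE y in \<nu>. norm ((G b y)\<^sup>2) \<le> norm (\<Sum>b\<in>Basis. (G b y)\<^sup>2)"
      using that by (intro AE_I2) (auto simp: sum_nonneg intro: member_le_sum)
  qed measurable
  have G2': "integrable \<mu> (\<lambda>x. (G b (\<phi> x))\<^sup>2)" if "b \<in> Basis" for b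
    by (rule integrable_distr[OF phi_meas G2[OF that]])
  have F2: "integrable \<mu> (\<lambda>x. (\<phi> (T x) \<bullet> b)\<^sup>2)" if "b \<in> Basis" for b
  proof (rule Bochner_Integration.integrable_bound[OF next_sq_integrable])
    show "AE x in \<mu>. norm ((\<phi> (T x) \<bullet> b)\<^sup>2) \<le> norm ((norm (\<phi> (T x)))\<^sup>2)"
      using Basis_le_norm[OF that] by (intro AE_I2) (simp add: abs_le_square_iff[symmetric])
  qed measurable
  have FG: "integrable \<mu> (\<lambda>x. G b (\<phi> x) * (\<phi> (T x) \<bullet> b))" if "b \<in> Basis" for b
  proof (rule Bochner_Integration.integrable_bound)
    show "integrable \<mu> (\<lambda>x. (G b (\<phi> x))\<^sup>2 + (\<phi> (T x) \<bullet> b)\<^sup>2)" using G2'[OF that] F2[OF that] by simp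
    have "\<bar>u * v\<bar> \<le> u\<^sup>2 + v\<^sup>2" for u v :: real
    proof -
      have "2 * (\<bar>u\<bar> * \<bar>v\<bar>) \<le> u\<^sup>2 + v\<^sup>2" using sum_squares_bound[of "\<bar>u\<bar>" "\<bar>v\<bar>"] by simp
      moreover have "0 \<le> \<bar>u\<bar> * \<bar>v\<bar>" by simp
      ultimately show ?thesis unfolding abs_mult by linarith
    qed
    then show "AE x in \<mu>. norm (G b (\<phi> x) * (\<phi> (T x) \<bullet> b)) \<le> norm ((G b (\<phi> x))\<^sup>2 + (\<phi> (T x) \<bullet> b)\<^sup>2)"
      by (intro AE_I2) (simp add: abs_of_nonneg)
  qed measurable
  have int_sq: "integrable \<mu> (\<lambda>x. (\<phi> (T x) \<bullet> b - G b (\<phi> x))\<^sup>2)"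
    and eq_sq: "(\<integral>x. (\<phi> (T x) \<bullet> b - G b (\<phi> x))\<^sup>2 \<partial>\<mu>) = (\<integral>x. (\<phi> (T x) \<bullet> b)\<^sup>2 \<partial>\<mu>) - (\<integral>y. (G b y)\<^sup>2 \<partial>\<nu>)"
    if b: "b \<in> Basis" for b
  proof -
    have exp: "(\<phi> (T x) \<bullet> b - G b (\<phi> x))\<^sup>2 =
        (\<phi> (T x) \<bullet> b)\<^sup>2 + ((G b (\<phi> x))\<^sup>2 - 2 * (G b (\<phi> x) * (\<phi> (T x) \<bullet> b)))" for x
      by (simp add: power2_eq_square algebra_simps)
    show "integrable \<mu> (\<lambda>x. (\<phi> (T x) \<bullet> b - G b (\<phi> x))\<^sup>2)"
      unfolding exp using F2[OF b] FG[OF b] G2'[OF b] by simp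
    \<comment> \<open>The test function is \<open>G b\<close> itself, which may be unbounded; hence
      the integrability established in \<open>FG\<close>.\<close>
    have "(\<integral>x. G b (\<phi> x) * (\<phi> (T x) \<bullet> b) \<partial>\<mu>) = (\<integral>y. (G b y)\<^sup>2 \<partial>\<nu>)"
      using G(2)[OF _ FG[OF b]] by (simp add: power2_eq_square)
    moreover have "(\<integral>x. (G b (\<phi> x))\<^sup>2 \<partial>\<mu>) = (\<integral>y. (G b y)\<^sup>2 \<partial>\<nu>)"
      by (rule integral_distr[symmetric]) measurable
    ultimately show "(\<integral>x. (\<phi> (T x) \<bullet> b - G b (\<phi> x))\<^sup>2 \<partial>\<mu>) = (\<integral>x. (\<phi> (T x) \<bullet> b)\<^sup>2 \<partial>\<mu>) - (\<integral>y. (G b y)\<^sup>2 \<partial>\<nu>)"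
      unfolding exp using F2[OF b] FG[OF b] G2'[OF b] by simp
  qed
  \<comment> \<open>Summed over the basis, both second moments equal the integral of
    \<open>H\<close>, so the total squared distance between \<open>\<phi> \<circ> T\<close> and its
    conditional mean is zero.\<close>
  have "(\<Sum>b\<in>Basis. \<integral>x. (\<phi> (T x) \<bullet> b - G b (\<phi> x))\<^sup>2 \<partial>\<mu>) =
      (\<Sum>b\<in>Basis. \<integral>x. (\<phi> (T x) \<bullet> b)\<^sup>2 \<partial>\<mu>) - (\<Sum>b\<in>Basis. \<integral>y. (G b y)\<^sup>2 \<partial>\<nu>)"
    by (simp add: eq_sq sum_subtractf)
  also have "(\<Sum>b\<in>Basis. \<integral>x. (\<phi> (T x) \<bullet> b)\<^sup>2 \<partial>\<mu>) = (\<integral>x. (norm (\<phi> (T x)))\<^sup>2 \<partial>\<mu>)"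
    unfolding norm_sq_eq_sum_Basis using F2 by (rule Bochner_Integration.integral_sum[symmetric])
  also have "\<dots> = (\<integral>y. H y \<partial>\<nu>)"
    using H(2)[of "\<lambda>_. 1"] next_sq_integrable by simp
  also have "\<dots> = (\<integral>y. (\<Sum>b\<in>Basis. (G b y)\<^sup>2) \<partial>\<nu>)"
    by (rule integral_cong_AE) (use H_eq in auto)
  also have "\<dots> = (\<Sum>b\<in>Basis. \<integral>y. (G b y)\<^sup>2 \<partial>\<nu>)"
    using G2 by (rule Bochner_Integration.integral_sum)
  finally have "(\<Sum>b\<in>Basis. \<integral>x. (\<phi> (T x) \<bullet> b - G b (\<phi> x))\<^sup>2 \<partial>\<mu>) = 0" by simp
  then have zero: "(\<integral>x. (\<phi> (T x) \<bullet> b - G b (\<phi> x))\<^sup>2 \<partial>\<mu>) = 0" if "b \<in> Basis" for b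
    using that by (subst (asm) sum_nonneg_eq_0_iff) auto
  have "AE x in \<mu>. \<forall>b\<in>Basis. \<phi> (T x) \<bullet> b = G b (\<phi> x)"
  proof (rule AE_finite_allI)
    fix b :: 'b assume b: "b \<in> Basis"
    have "AE x in \<mu>. (\<phi> (T x) \<bullet> b - G b (\<phi> x))\<^sup>2 = 0"
      using zero[OF b] int_sq[OF b] by (subst (asm) integral_nonneg_eq_0_iff_AE) auto
    then show "AE x in \<mu>. \<phi> (T x) \<bullet> b = G b (\<phi> x)" by simp
  qed simp
  then have "AE x in \<mu>. \<phi> (T x) = (\<Sum>b\<in>Basis. G b (\<phi> x) *\<^sub>R b)"
  proof eventually_elim
    case (elim x)
    then have "(\<Sum>b\<in>Basis. G b (\<phi> x) *\<^sub>R b) = (\<Sum>b\<in>Basis. (\<phi> (T x) \<bullet> b) *\<^sub>R b)" by simp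
    then show ?case by (simp add: euclidean_representation)
  qed
  moreover have "(\<lambda>z. \<Sum>b\<in>Basis. G b z *\<^sub>R b) \<in> borel_measurable borel" by measurable
  ultimately show ?thesis by (intro bexI[of _ "\<lambda>z. \<Sum>b\<in>Basis. G b z *\<^sub>R b"]) auto
qed

text \<open>On the set where the factorization holds, \<open>\<phi> x\<close> determines
  \<open>\<phi> (T x)\<close>; this set is measurable and has full measure.\<close>

lemma as_predictable_imp_as_det_predictable:
  assumes "as_predictable \<mu> T \<phi>"
  shows "as_det_predictable \<mu> T \<phi>"
proof -
  obtain G where [measurable]: "G \<in> borel_measurable borel" and G: "AE x in \<mu>. \<phi> (T x) = G (\<phi> x)"
    using as_predictable_imp_factor[OF assms] by blast
  define Xh where "Xh = {x \<in> space \<mu>. \<phi> (T x) = G (\<phi> x)}"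
  have "Xh \<in> sets \<mu>" unfolding Xh_def by measurable
  moreover have "space \<mu> - Xh \<in> null_sets \<mu>"
  proof -
    have "{x \<in> space \<mu>. \<not> \<phi> (T x) = G (\<phi> x)} \<in> null_sets \<mu>"
      using G by (subst (asm) AE_iff_null) auto
    moreover have "space \<mu> - Xh = {x \<in> space \<mu>. \<not> \<phi> (T x) = G (\<phi> x)}" by (auto simp: Xh_def)
    ultimately show ?thesis by simp
  qed
  ultimately show ?thesis
    unfolding as_det_predictable_def full_measure_set_def by (intro exI[of _ Xh]) (auto simp: Xh_def)
qed

lemma prediction_map_conclusions:
  assumes "prediction_map \<mu> T \<phi> Xh S"
  shows "in_L2 (restrict_space \<nu> (\<phi> ` Xh)) S"
    and "y \<in> measure_support \<nu> \<Longrightarrow> 0 < \<epsilon> \<Longrightarrow> \<sigma>\<^sub>p \<mu> T \<phi> \<epsilon> y =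
      sqrt (1 / measure \<nu> (ball y \<epsilon>) *
        (LINT z:(ball y \<epsilon> \<inter> \<phi> ` Xh)|\<nu>. (norm (S z - \<chi>\<^sub>p \<mu> T \<phi> \<epsilon> y))\<^sup>2))"
    and "AE y in \<nu>. ((\<lambda>\<epsilon>. \<sigma>\<^sub>p \<mu> T \<phi> \<epsilon> y) \<longlongrightarrow> 0) (at_right 0)"
    and "as_predictable \<mu> T \<phi>"
proof -
  define B where "B = \<phi> ` Xh"
  \<comment> \<open>Extension by \<open>0\<close> turns the partial map \<open>S\<close> into a
    Borel function on the whole space, to which the factorization lemmas apply.\<close>
  define G where "G z = (if z \<in> B then S z else 0)" for z
  have full: "Xh \<in> sets \<mu>" "space \<mu> - Xh \<in> null_sets \<mu>" and [measurable]: "B \<in> sets borel"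
    and S: "S \<in> borel_measurable (restrict_space borel B)" "\<And>x. x \<in> Xh \<Longrightarrow> \<phi> (T x) = S (\<phi> x)"
    using assms by (auto simp: prediction_map_def full_measure_set_def B_def)
  have G_meas [measurable]: "G \<in> borel_measurable borel"
    using S(1) unfolding G_def by (subst (asm) measurable_restrict_space_iff[where c = 0]) auto
  have AE_Xh: "AE x in \<mu>. x \<in> Xh"
    using full(2) by (rule AE_I') auto
  then have G: "AE x in \<mu>. \<phi> (T x) = G (\<phi> x)"
    by eventually_elim (auto simp: G_def B_def S(2))
  have "AE x in \<mu>. \<phi> x \<in> B" using AE_Xh by eventually_elim (simp add: B_def)
  \<comment> \<open>The image carries full push-forward measure, so passing between \<open>S\<close>
    on \<open>B\<close> and the total \<open>G\<close> changes no integral.\<close>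
  then have AE_B: "AE z in \<nu>. z \<in> B" by (subst AE_distr_iff) auto
  show "in_L2 (restrict_space \<nu> (\<phi> ` Xh)) S"
    unfolding in_L2_def B_def[symmetric]
  proof
    show S_meas: "S \<in> borel_measurable (restrict_space \<nu> B)"
      using G_meas unfolding G_def by (subst measurable_restrict_space_iff[where c = 0]) auto
    have "integrable \<nu> (\<lambda>z. (norm (G z))\<^sup>2)"
      using next_sq_integrable integrable_factor[OF G_meas _ G, of "\<lambda>v. (norm v)\<^sup>2"] by simp
    moreover have "(norm (G z))\<^sup>2 = indicator B z *\<^sub>R (norm (S z))\<^sup>2" for z by (simp add: G_def)
    ultimately show "integrable (restrict_space \<nu> B) (\<lambda>z. (norm (S z))\<^sup>2)"
      by (subst integrable_restrict_space) auto
  qed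
  show "AE y in \<nu>. ((\<lambda>\<epsilon>. \<sigma>\<^sub>p \<mu> T \<phi> \<epsilon> y) \<longlongrightarrow> 0) (at_right 0)"
    by (rule pred_error_tendsto_0[OF G_meas G])
  show "as_predictable \<mu> T \<phi>" by (rule as_predictableI[OF G_meas G])
  show "\<sigma>\<^sub>p \<mu> T \<phi> \<epsilon> y = sqrt (1 / measure \<nu> (ball y \<epsilon>) *
      (LINT z:(ball y \<epsilon> \<inter> \<phi> ` Xh)|\<nu>. (norm (S z - \<chi>\<^sub>p \<mu> T \<phi> \<epsilon> y))\<^sup>2))"
    if "y \<in> measure_support \<nu>" "0 < \<epsilon>" for y \<epsilon>
  proof -
    let ?c = "\<chi>\<^sub>p \<mu> T \<phi> \<epsilon> y"
    have [measurable]: "ball y \<epsilon> \<in> sets borel" by simp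
    have "indicator (ball y \<epsilon> \<inter> B) z *\<^sub>R (norm (S z - ?c))\<^sup>2 = indicator (ball y \<epsilon> \<inter> B) z *\<^sub>R (norm (G z - ?c))\<^sup>2" for z
      by (simp add: G_def indicator_def)
    then have "(LINT z:(ball y \<epsilon> \<inter> B)|\<nu>. (norm (S z - ?c))\<^sup>2) = (LINT z:(ball y \<epsilon> \<inter> B)|\<nu>. (norm (G z - ?c))\<^sup>2)"
      unfolding set_lebesgue_integral_def by (simp only:)
    also have "\<dots> = (LINT z:ball y \<epsilon>|\<nu>. (norm (G z - ?c))\<^sup>2)"
      unfolding set_lebesgue_integral_def
    proof (rule integral_cong_AE)
      show "AE z in \<nu>. indicator (ball y \<epsilon> \<inter> B) z *\<^sub>R (norm (G z - ?c))\<^sup>2 = indicator (ball y \<epsilon>) z *\<^sub>R (norm (G z - ?c))\<^sup>2"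
        using AE_B by eventually_elim (simp add: indicator_def)
    qed measurable
    also have "\<dots> = (LINT x:phi_ball \<mu> \<phi> \<epsilon> y|\<mu>. (norm (\<phi> (T x) - ?c))\<^sup>2)"
      using G by (intro set_integral_factor[symmetric]) measurable
    finally show ?thesis
      by (simp add: pred_error_def measure_phi_ball B_def)
  qed
qed

end

section \<open>Existence of a Borel prediction map\<close>

text \<open>
  Shrinking the full-measure set to a \<open>\<sigma>\<close>-compact one makes its image under \<open>\<phi>\<close> and all preimages
  of closed sets under the prediction map \<open>\<sigma>\<close>-compact.
\<close>
lemma prediction_map_exists:
  fixes \<mu> :: "'a::{second_countable_topology, complete_space} measure" and \<phi> :: "'a \<Rightarrow> 'b::euclidean_space"
  assumes X: "X \<in> sets borel" and \<mu>: "prob_space \<mu>" "sets \<mu> = sets (restrict_space borel X)"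
    and T: "T \<in> X \<rightarrow> X" and cont: "continuous_on X \<phi>" "continuous_on X (\<lambda>x. \<phi> (T x))"
    and det: "as_det_predictable \<mu> T \<phi>"
  shows "\<exists>Xh S. prediction_map \<mu> T \<phi> Xh S"
proof -
  interpret prob_space \<mu> by fact
  have space: "space \<mu> = X" using sets_eq_imp_space_eq[OF \<mu>(2)] by (simp add: space_restrict_space)
  have sets_iff: "A \<in> sets \<mu> \<longleftrightarrow> A \<subseteq> X \<and> A \<in> sets borel" for A
    unfolding \<mu>(2) using X by (subst sets_restrict_space_iff) auto
  obtain Y where Y: "Y \<in> sets \<mu>" "space \<mu> - Y \<in> null_sets \<mu>"
    "\<And>x1 x2. x1 \<in> Y \<Longrightarrow> x2 \<in> Y \<Longrightarrow> \<phi> x1 = \<phi> x2 \<Longrightarrow> \<phi> (T x1) = \<phi> (T x2)"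
    using det by (auto simp: as_det_predictable_def full_measure_set_def)
  have Y': "Y \<subseteq> X" "Y \<in> sets borel" using Y(1) sets_iff by auto
  have "measure \<mu> (space \<mu> - Y) = 0" using Y(2) by (simp add: measure_eq_0_null_sets)
  then have Y1: "measure \<mu> Y = 1" using prob_compl[OF Y(1)] by simp
  \<comment> \<open>Inner regularity concerns Borel measures on the whole space, so
    \<open>\<mu>\<close> is first transported there from its carrier \<open>X\<close>.\<close>
  define M where "M = distr \<mu> borel (\<lambda>x. x)"
  have id_meas: "(\<lambda>x. x) \<in> measurable \<mu> borel"
    unfolding measurable_cong_sets[OF \<mu>(2) refl] by (rule measurable_restrict_space1) simp
  interpret M: prob_space M unfolding M_def by (rule prob_space_distr[OF id_meas])
  have M: "measure M A = measure \<mu> A" if "A \<in> sets \<mu>" for A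
    using that by (auto simp: M_def measure_distr[OF id_meas] sets_iff space Int_absorb2)
  have "\<exists>K. compact K \<and> K \<subseteq> Y \<and> 1 < measure \<mu> K + inverse (real (Suc n))" for n
  proof -
    have "sets M = sets borel" by (simp add: M_def)
    moreover have "emeasure M (space M) \<noteq> \<infinity>" using M.emeasure_finite[of "space M"] by simp
    moreover have "{K. K \<subseteq> Y \<and> compact K} \<noteq> {}" by (auto intro: exI[of _ "{}"])
    ultimately have "\<exists>K\<in>{K. K \<subseteq> Y \<and> compact K}. emeasure M Y < emeasure M K + ennreal (inverse (real (Suc n)))"
      by (intro SUP_approx_ennreal inner_regular Y') auto
    then obtain K where K: "K \<subseteq> Y" "compact K" "measure M Y < measure M K + inverse (real (Suc n))"
      by (auto simp: M.emeasure_eq_measure ennreal_less_iff simp flip: ennreal_plus)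
    moreover have "K \<in> sets \<mu>" using K Y' by (auto simp: sets_iff intro: borel_compact)
    ultimately show ?thesis using M[OF Y(1)] M[of K] Y1 by auto
  qed
  then have "\<forall>n. \<exists>K. compact K \<and> K \<subseteq> Y \<and> 1 < measure \<mu> K + inverse (real (Suc n))" by blast
  from choice[OF this] obtain K where K: "\<And>n. compact (K n)" "\<And>n. K n \<subseteq> Y"
    "\<And>n. 1 < measure \<mu> (K n) + inverse (real (Suc n))" by blast
  define Xh where "Xh = (\<Union>n. K n)"
  have Xh_Y: "Xh \<subseteq> Y" using K(2) by (auto simp: Xh_def)
  have Xh_sets: "Xh \<in> sets \<mu>"
    unfolding sets_iff
  proof
    show "Xh \<subseteq> X" using Xh_Y Y'(1) by blast
    show "Xh \<in> sets borel"
      unfolding Xh_def using borel_compact[OF K(1)] by (intro sets.countable_UN) auto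
  qed
  have Xh1: "1 \<le> measure \<mu> Xh"
  proof (rule LIMSEQ_le_const2)
    show "(\<lambda>n. 1 - inverse (real (Suc n))) \<longlonglongrightarrow> 1"
      using tendsto_diff[OF tendsto_const LIMSEQ_inverse_real_of_nat, of "1::real"] by simp
    have "1 - inverse (real (Suc n)) \<le> measure \<mu> Xh" for n
      using K(3)[of n] finite_measure_mono[OF _ Xh_sets, of "K n"] by (fastforce simp: Xh_def)
    then show "\<exists>N. \<forall>n\<ge>N. 1 - inverse (real (Suc n)) \<le> measure \<mu> Xh" by blast
  qed
  have "measure \<mu> (space \<mu> - Xh) = 0"
    using Xh1 prob_le_1[of Xh] prob_compl[OF Xh_sets] by simp
  then have Xh_full: "full_measure_set \<mu> Xh"
    using Xh_sets by (simp add: full_measure_set_def null_sets_def emeasure_eq_measure)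
  define S where "S z = \<phi> (T (SOME x. x \<in> Xh \<and> \<phi> x = z))" for z
  have S: "S (\<phi> x) = \<phi> (T x)" if "x \<in> Xh" for x
  proof -
    define x' where "x' = (SOME x'. x' \<in> Xh \<and> \<phi> x' = \<phi> x)"
    have "x' \<in> Xh \<and> \<phi> x' = \<phi> x" unfolding x'_def by (rule someI[of _ x]) (use that in simp)
    then have "\<phi> (T x') = \<phi> (T x)" using Y(3)[of x' x] Xh_Y that by blast
    then show ?thesis by (simp add: S_def x'_def)
  qed
  have K_X: "K n \<subseteq> X" for n using K(2) Y'(1) by blast
  \<comment> \<open>A closed condition cuts each compact \<open>K n\<close> in a compact set, whose
    continuous image is again compact.\<close>
  have image_borel: "(\<Union>n. \<phi> ` (K n \<inter> (\<lambda>x. \<phi> (T x)) -` C)) \<in> sets borel" if "closed C" for C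
  proof (intro sets.countable_UN image_subsetI borel_compact compact_continuous_image)
    fix n
    show "continuous_on (K n \<inter> (\<lambda>x. \<phi> (T x)) -` C) \<phi>"
      by (rule continuous_on_subset[OF cont(1)]) (use K_X[of n] in auto)
    have "closed (K n \<inter> (\<lambda>x. \<phi> (T x)) -` C)"
      using continuous_on_subset[OF cont(2) K_X] compact_imp_closed[OF K(1)] that
      by (rule continuous_closed_preimage)
    from compact_Int_closed[OF K(1)[of n] this] show "compact (K n \<inter> (\<lambda>x. \<phi> (T x)) -` C)"
      by (simp add: Int_left_absorb)
  qed
  have Xh_image: "\<phi> ` Xh \<in> sets borel"
  proof -
    have "\<phi> ` Xh = (\<Union>n. \<phi> ` (K n \<inter> (\<lambda>x. \<phi> (T x)) -` UNIV))" by (auto simp: Xh_def)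
    then show ?thesis using image_borel[of UNIV] by simp
  qed
  have "S \<in> borel_measurable (restrict_space borel (\<phi> ` Xh))"
  proof (rule borel_measurableI)
    fix U :: "'b set" assume "open U"
    \<comment> \<open>Passing to the complement replaces the open \<open>U\<close> by the closed
      \<open>- U\<close>, for which the image is known to be Borel.\<close>
    have eq: "S -` U \<inter> space (restrict_space borel (\<phi> ` Xh)) =
        \<phi> ` Xh - (\<Union>n. \<phi> ` (K n \<inter> (\<lambda>x. \<phi> (T x)) -` (- U)))"
    proof -
      have "(\<Union>n. \<phi> ` (K n \<inter> (\<lambda>x. \<phi> (T x)) -` (- U))) = {z \<in> \<phi> ` Xh. S z \<notin> U}"
      proof (intro set_eqI iffI)
        fix z assume "z \<in> (\<Union>n. \<phi> ` (K n \<inter> (\<lambda>x. \<phi> (T x)) -` (- U)))"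
        then obtain n x where x: "x \<in> K n" "\<phi> (T x) \<notin> U" "z = \<phi> x" by auto
        then have "x \<in> Xh" by (auto simp: Xh_def)
        then show "z \<in> {z \<in> \<phi> ` Xh. S z \<notin> U}" using x S[of x] by simp
      next
        fix z assume "z \<in> {z \<in> \<phi> ` Xh. S z \<notin> U}"
        then obtain x where x: "x \<in> Xh" "z = \<phi> x" "\<phi> (T x) \<notin> U" using S by auto
        then show "z \<in> (\<Union>n. \<phi> ` (K n \<inter> (\<lambda>x. \<phi> (T x)) -` (- U)))" by (auto simp: Xh_def)
      qed
      then show ?thesis by (auto simp: space_restrict_space)
    qed
    show "S -` U \<inter> space (restrict_space borel (\<phi> ` Xh)) \<in> sets (restrict_space borel (\<phi> ` Xh))"
      unfolding eq using Xh_image image_borel[of "- U"] \<open>open U\<close>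
      by (subst sets_restrict_space_iff) (auto simp: closed_Compl)
  qed
  moreover have "S \<in> \<phi> ` Xh \<rightarrow> \<phi> ` space \<mu>"
  proof
    fix z assume "z \<in> \<phi> ` Xh"
    then obtain x where x: "x \<in> Xh" "z = \<phi> x" by blast
    then have "T x \<in> X" using Xh_Y Y'(1) T by blast
    then show "S z \<in> \<phi> ` space \<mu>" using x S by (simp add: space)
  qed
  ultimately have "prediction_map \<mu> T \<phi> Xh S"
    using Xh_full Xh_image S by (simp add: prediction_map_def)
  then show ?thesis by blast
qed

section \<open>Continuity and square integrability of the delay map\<close>

text \<open>The two claims are joined in one induction because continuity of the composition
  requires the iterates to stay in \<open>X\<close>.\<close>

lemma funpow_continuous_on:
  assumes "continuous_on X T" "T \<in> X \<rightarrow> X"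
  shows "continuous_on X (T ^^ n) \<and> T ^^ n \<in> X \<rightarrow> X"
proof (induction n)
  case (Suc n)
  then have "continuous_on X (T \<circ> T ^^ n)"
    by (intro continuous_on_compose continuous_on_subset[OF assms(1)]) auto
  then show ?case using Suc assms(2) by (auto simp: Pi_iff)
qed simp

lemma continuous_on_delay_map:
  assumes "continuous_on X T" "T \<in> X \<rightarrow> X" "continuous_on X h"
  shows "continuous_on X (delay_map T h)"
proof -
  have "continuous_on X (\<lambda>x. h ((T ^^ n) x))" for n
    using funpow_continuous_on[OF assms(1,2), of n]
    by (intro continuous_on_compose2[OF assms(3)]) auto
  then show ?thesis unfolding delay_map_def by (intro continuous_intros)
qed

lemma bounded_imp_next_in_L2:
  fixes \<phi> :: "'a \<Rightarrow> real ^ ('k :: {finite, linorder})"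
  assumes "prob_space \<mu>" and [measurable]: "(\<lambda>x. \<phi> (T x)) \<in> borel_measurable \<mu>"
    and T: "T \<in> space \<mu> \<rightarrow> space \<mu>" and \<phi>: "\<phi> = delay_map T h" and "bounded (h ` space \<mu>)"
  shows "in_L2 \<mu> (\<lambda>x. \<phi> (T x))"
proof -
  interpret prob_space \<mu> by fact
  obtain B where B: "\<And>x. x \<in> space \<mu> \<Longrightarrow> \<bar>h x\<bar> \<le> B"
    using assms(5) by (auto simp: bounded_iff)
  have Tn: "(T ^^ n) x \<in> space \<mu>" if "x \<in> space \<mu>" for n x
    using that T by (induction n) auto
  have bound: "norm (\<phi> (T x)) \<le> real CARD('k) * B" if "x \<in> space \<mu>" for x
  proof -
    have "norm (\<phi> (T x)) \<le> (\<Sum>i\<in>UNIV. \<bar>\<phi> (T x) $ i\<bar>)" by (rule norm_le_l1_cart)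
    also have "\<dots> \<le> (\<Sum>i\<in>(UNIV :: 'k set). B)"
      using that T by (intro sum_mono) (auto simp: \<phi> delay_map_def intro!: B Tn)
    finally show ?thesis by simp
  qed
  have "integrable \<mu> (\<lambda>x. (norm (\<phi> (T x)))\<^sup>2)"
  proof (rule integrable_const_bound)
    show "AE x in \<mu>. norm ((norm (\<phi> (T x)))\<^sup>2) \<le> (real CARD('k) * B)\<^sup>2"
      using bound by (intro AE_I2) (simp add: power_mono)
  qed measurable
  then show ?thesis by (simp add: in_L2_def)
qed

text \<open>The coordinates of \<open>\<phi> (T x)\<close> are values of \<open>h\<close> at
  iterates of positive order; invariance gives every \<open>h \<circ> T ^^ n\<close> the square
  integrability of \<open>h\<close>.\<close>

lemma invariant_imp_next_in_L2:
  fixes \<phi> :: "'a \<Rightarrow> real ^ ('k :: {finite, linorder})"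
  assumes [measurable]: "(\<lambda>x. \<phi> (T x)) \<in> borel_measurable \<mu>"
    and inv: "invariant_measure \<mu> T" and \<phi>: "\<phi> = delay_map T h" and h: "in_L2 \<mu> h"
  shows "in_L2 \<mu> (\<lambda>x. \<phi> (T x))"
proof -
  have T: "T \<in> measurable \<mu> \<mu>" "distr \<mu> \<mu> T = \<mu>" using inv by (auto simp: invariant_measure_def)
  have shift: "integrable \<mu> (\<lambda>x. g (T x))" if "integrable \<mu> g" for g :: "'a \<Rightarrow> real"
    using integrable_distr[OF T(1), of g] that T(2) by simp
  have Tn: "integrable \<mu> (\<lambda>x. (h ((T ^^ n) x))\<^sup>2)" for n
  proof (induction n)
    case 0
    then show ?case using h by (simp add: in_L2_def)
  next
    case (Suc n)
    from shift[OF this] show ?case by (simp add: funpow_swap1)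
  qed
  have "(norm (\<phi> (T x)))\<^sup>2 = (\<Sum>i\<in>UNIV. (h ((T ^^ Suc (card {..<i::'k})) x))\<^sup>2)" for x
    unfolding power2_norm_eq_inner inner_vec_def
    by (simp add: \<phi> delay_map_def power2_eq_square funpow_swap1)
  then have "integrable \<mu> (\<lambda>x. (norm (\<phi> (T x)))\<^sup>2)"
    using Tn by (simp only:) (intro Bochner_Integration.integrable_sum)
  then show ?thesis by (simp add: in_L2_def)
qed

theorem theorem1p17:
  fixes X :: "(real ^ 'n) set"
    and \<mu> :: "(real ^ 'n) measure"
    and T :: "real ^ 'n \<Rightarrow> real ^ 'n"
    and h :: "real ^ 'n \<Rightarrow> real"
    and \<phi> :: "real ^ 'n \<Rightarrow> real ^ ('k :: {finite, linorder})"
  assumes X: "X \<in> sets borel"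
    and \<mu>: "prob_space \<mu>" "sets \<mu> = sets (restrict_space borel X)"
    and T: "continuous_on X T" "T \<in> X \<rightarrow> X"
    and h: "continuous_on X h"
    and \<phi>: "\<phi> = delay_map T h"
  shows
    "(bounded (h ` X) \<longrightarrow> in_L2 \<mu> (\<phi> \<circ> T)) \<and>
     ((in_L2 \<mu> (\<phi> \<circ> T) \<or> (invariant_measure \<mu> T \<and> in_L2 \<mu> h)) \<and> as_det_predictable \<mu> T \<phi> \<longrightarrow>
        (\<exists>Xh S. prediction_map \<mu> T \<phi> Xh S) \<and>
        (\<forall>Xh S. prediction_map \<mu> T \<phi> Xh S \<longrightarrow>
           in_L2 (restrict_space (distr \<mu> borel \<phi>) (\<phi> ` Xh)) S \<and>
           (AE y in distr \<mu> borel \<phi>. y \<in> \<phi> ` X \<longrightarrow>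
              (\<forall>\<epsilon>>0. pred_error_exists \<mu> T \<phi> \<epsilon> y \<and>
                 \<sigma>\<^sub>p \<mu> T \<phi> \<epsilon> y =
                   sqrt (1 / measure (distr \<mu> borel \<phi>) (ball y \<epsilon>) *
                     (LINT z:(ball y \<epsilon> \<inter> \<phi> ` Xh)|distr \<mu> borel \<phi>.
                        (norm (S z - \<chi>\<^sub>p \<mu> T \<phi> \<epsilon> y))\<^sup>2))) \<and>
              ((\<lambda>\<epsilon>. \<sigma>\<^sub>p \<mu> T \<phi> \<epsilon> y) \<longlongrightarrow> 0) (at_right 0))) \<and>
        as_predictable \<mu> T \<phi>) \<and>
     (compact X \<longrightarrow> (as_det_predictable \<mu> T \<phi> \<longleftrightarrow> as_predictable \<mu> T \<phi>))"
proof -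
  have space: "space \<mu> = X" using sets_eq_imp_space_eq[OF \<mu>(2)] by (simp add: space_restrict_space)
  have cont: "continuous_on X \<phi>" unfolding \<phi> by (rule continuous_on_delay_map[OF T h])
  have cont_next: "continuous_on X (\<lambda>x. \<phi> (T x))"
    using T by (intro continuous_on_compose2[OF cont]) auto
  have meas: "\<phi> \<in> borel_measurable \<mu>" "(\<lambda>x. \<phi> (T x)) \<in> borel_measurable \<mu>"
    unfolding measurable_cong_sets[OF \<mu>(2) refl]
    using cont cont_next by (auto intro: borel_measurable_continuous_on_restrict)
  have bounded_L2: "in_L2 \<mu> (\<lambda>x. \<phi> (T x))" if "bounded (h ` X)"
    using that T(2) by (intro bounded_imp_next_in_L2[OF \<mu>(1) meas(2) _ \<phi>]) (simp_all add: space)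
  have invariant_L2: "in_L2 \<mu> (\<lambda>x. \<phi> (T x))" if "invariant_measure \<mu> T" "in_L2 \<mu> h"
    by (rule invariant_imp_next_in_L2[OF meas(2) that(1) \<phi> that(2)])
  have prediction: "prediction \<mu> T \<phi>" if "in_L2 \<mu> (\<lambda>x. \<phi> (T x))"
    using \<mu>(1) meas(1) that by (simp add: prediction_def prediction_axioms_def)
  have exists: "\<exists>Xh S. prediction_map \<mu> T \<phi> Xh S" if "as_det_predictable \<mu> T \<phi>"
    by (rule prediction_map_exists[OF X \<mu> T(2) cont cont_next that])
  have S_L2: "in_L2 (restrict_space (distr \<mu> borel \<phi>) (\<phi> ` Xh)) S"
    if "in_L2 \<mu> (\<lambda>x. \<phi> (T x))" "prediction_map \<mu> T \<phi> Xh S" for Xh S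
    by (rule prediction.prediction_map_conclusions(1)[OF prediction[OF that(1)] that(2)])
  have error: "AE y in distr \<mu> borel \<phi>. y \<in> \<phi> ` X \<longrightarrow>
      (\<forall>\<epsilon>>0. pred_error_exists \<mu> T \<phi> \<epsilon> y \<and>
        \<sigma>\<^sub>p \<mu> T \<phi> \<epsilon> y =
          sqrt (1 / measure (distr \<mu> borel \<phi>) (ball y \<epsilon>) *
            (LINT z:(ball y \<epsilon> \<inter> \<phi> ` Xh)|distr \<mu> borel \<phi>. (norm (S z - \<chi>\<^sub>p \<mu> T \<phi> \<epsilon> y))\<^sup>2))) \<and>
      ((\<lambda>\<epsilon>. \<sigma>\<^sub>p \<mu> T \<phi> \<epsilon> y) \<longlongrightarrow> 0) (at_right 0)"
    if L2: "in_L2 \<mu> (\<lambda>x. \<phi> (T x))" and S: "prediction_map \<mu> T \<phi> Xh S" for Xh S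
  proof -
    interpret prediction \<mu> T \<phi> by (rule prediction[OF L2])
    have "AE y in distr \<mu> borel \<phi>. y \<in> measure_support (distr \<mu> borel \<phi>)"
      by (rule AE_in_measure_support) simp
    with prediction_map_conclusions(3)[OF S] show ?thesis
      by eventually_elim (intro impI conjI allI pred_error_exists prediction_map_conclusions(2)[OF S])
  qed
  have as_pred: "as_predictable \<mu> T \<phi>"
    if "in_L2 \<mu> (\<lambda>x. \<phi> (T x))" "as_det_predictable \<mu> T \<phi>"
    using exists[OF that(2)] prediction.prediction_map_conclusions(4)[OF prediction[OF that(1)]] by blast
  have compact_iff: "as_det_predictable \<mu> T \<phi> \<longleftrightarrow> as_predictable \<mu> T \<phi>" if "compact X"
  proof -
    \<comment> \<open>Both directions of the equivalence need square integrability; here it comes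
      from boundedness of \<open>h\<close> on the compact \<open>X\<close>.\<close>
    have L2: "in_L2 \<mu> (\<lambda>x. \<phi> (T x))"
      using compact_continuous_image[OF h that] by (intro bounded_L2 compact_imp_bounded)
    show ?thesis
      using as_pred[OF L2] prediction.as_predictable_imp_as_det_predictable[OF prediction[OF L2]]
      by blast
  qed
  have L2: "in_L2 \<mu> (\<lambda>x. \<phi> (T x))"
    if "(in_L2 \<mu> (\<lambda>x. \<phi> (T x)) \<or> (invariant_measure \<mu> T \<and> in_L2 \<mu> h)) \<and> as_det_predictable \<mu> T \<phi>"
    using that invariant_L2 by blast
  show ?thesis
    unfolding comp_def
    by (intro conjI impI allI, erule bounded_L2, rule exists, erule conjunct2,
        rule S_L2[OF L2], assumption+, rule error[OF L2], assumption+,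
        rule as_pred[OF L2], assumption, erule conjunct2, erule compact_iff)
qed

end
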